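(* Let $\ell : \mathbb{N} \to \mathbb{N}$ be a function with $\ell(n) \in \omega(n^2)$, i.e. $\ell(n)/n^2 \to \infty$ as $n \to \infty$. For each $n \geq 2$ let $V$ and $W$ be two independent random walks of length $\ell = \ell(n)$ in $U_n(\mathbb{Z})$, and let $G = \langle V, W \rangle \leq U_n(\mathbb{Z})$ be the subgroup they generate. Then asymptotically almost surely $G$ has full step, that is, $\mathbb{P}[\operatorname{step}(G) = n-1] \to 1$ as $n \to \infty$.
   Context: $U_n(\mathbb{Z})$ is the group of $n \times n$ upper triangular integer matrices with ones on the diagonal. For $1 \leq i < n$, $E_{i,i+1}$ denotes the matrix with $1$'s on the diagonal, a $1$ at position $(i,i+1)$ and $0$'s elsewhere, and $S = \{E_{i,i+1}^{\pm 1} : 1 \leq i < n\}$ is the standard generating set of $U_n(\mathbb{Z})$. A random walk of length $\ell$ in $U_n(\mathbb{Z})$ is a random product $V = V_1 V_2 \cdots V_\ell$ in which each $V_i$ is chosen independently and uniformly from $S$. For a nilpotent group $G$, the lower central series is indexed by $G_0 = G$ and $G_{i+1} = [G, G_i]$; the step of $G$, written $\operatorname{step}(G)$, is the first index $r$ for which $G_r$ is trivial. With this convention $\operatorname{step}(U_n(\mathbb{Z})) = n-1$, so any subgroup $G \leq U_n(\mathbb{Z})$ has $\operatorname{step}(G) \leq n-1$; $G$ is said to have full step if $\operatorname{step}(G) = n-1$. A property holds asymptotically almost surely if its probability tends to $1$ as $n \to \infty$. *)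

theory Defs
  imports
    "HOL-Probability.Probability"
    "HOL-Library.Landau_Symbols"
    "HOL-Algebra.Elementary_Groups"
    "Jordan_Normal_Form.Matrix"
begin

definition unitriangular_group :: "nat \<Rightarrow> int mat monoid" where
  "unitriangular_group n =
     \<lparr>carrier = {A \<in> carrier_mat n n. upper_triangular A \<and> (\<forall>i<n. A $$ (i, i) = 1)},
      mult = (*), one = 1\<^sub>m n\<rparr>"

text \<open>Matrix indices start at \<open>0\<close>: the matrix written \<open>E\<close> with subscripts \<open>i, i + 1\<close>,
  \<open>1 \<le> i < n\<close>, is \<open>elementary_unitriangular n (i - 1)\<close>.\<close>

definition elementary_unitriangular :: "nat \<Rightarrow> nat \<Rightarrow> int mat" where
  "elementary_unitriangular n i =
     Matrix.mat n n (\<lambda>(r, c). if r = c \<or> (r = i \<and> c = Suc i) then 1 else 0)"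

definition standard_generators :: "nat \<Rightarrow> int mat set" where
  "standard_generators n =
     (\<Union>i\<in>{i. Suc i < n}. {elementary_unitriangular n i,
        inv\<^bsub>unitriangular_group n\<^esub> (elementary_unitriangular n i)})"

text \<open>The law of the product of \<open>l\<close> independent uniform generators. For \<open>n < 2\<close> there are no
  generators, and \<open>pmf_of_set\<close> of the empty set is unspecified.\<close>

definition random_walk :: "nat \<Rightarrow> nat \<Rightarrow> int mat pmf" where
  "random_walk n l =
     map_pmf (\<lambda>Vs. foldr (mult (unitriangular_group n)) Vs \<one>\<^bsub>unitriangular_group n\<^esub>)
       (replicate_pmf l (pmf_of_set (standard_generators n)))"

definition commutator_subgroup :: "('a, 'b) monoid_scheme \<Rightarrow> 'a set \<Rightarrow> 'a set \<Rightarrow> 'a set" where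
  "commutator_subgroup G H K =
     generate G (\<Union>h\<in>H. \<Union>k\<in>K. {h \<otimes>\<^bsub>G\<^esub> k \<otimes>\<^bsub>G\<^esub> inv\<^bsub>G\<^esub> h \<otimes>\<^bsub>G\<^esub> inv\<^bsub>G\<^esub> k})"

primrec lower_central :: "('a, 'b) monoid_scheme \<Rightarrow> nat \<Rightarrow> 'a set" where
  "lower_central G 0 = carrier G"
| "lower_central G (Suc i) = commutator_subgroup G (carrier G) (lower_central G i)"

text \<open>Meaningful for nilpotent groups only; otherwise no such index exists and the value is
  unspecified.\<close>

definition nilpotency_step :: "('a, 'b) monoid_scheme \<Rightarrow> nat" where
  "nilpotency_step G = (LEAST r. lower_central G r = {\<one>\<^bsub>G\<^esub>})"

end

theory Submission
  imports Defs "HOL-Real_Asymp.Real_Asymp"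
begin

text \<open>Write \<open>v\<^sub>j\<close>, \<open>w\<^sub>j\<close> for the superdiagonal entries of \<open>V\<close>, \<open>W\<close>, counted from \<open>0\<close>. If
  \<open>v\<^sub>0 \<noteq> 0\<close> and \<open>(v\<^sub>0, w\<^sub>0)\<close> is not parallel to any other pair \<open>(v\<^sub>j, w\<^sub>j)\<close>, then the superdiagonal
  of \<open>x = V ^ (-w\<^sub>0) W ^ v\<^sub>0\<close> vanishes exactly at position \<open>0\<close>, so the iterated commutator
  \<open>[x, [x, \<dots>, [x, V]]]\<close> of length \<open>n - 1\<close> has a nonzero top-right corner and the step is full.

  Each \<open>v\<^sub>j\<close> is a lazy walk on the integers whose law is symmetric, decreasing in the absolute value,
  and at most \<open>\<sigma> = \<surd>(n / l)\<close> at \<open>0\<close>; moreover the law of \<open>(v\<^sub>0, v\<^sub>j)\<close> has all these monotonicity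
  properties in the second variable. Monotonicity bounds the probability of a nonzero multiple of \<open>d\<close>
  by \<open>1 / d\<close>, so \<open>gcd v\<^sub>0 w\<^sub>0 < m\<close> up to probability \<open>1 / (m - 1)\<close>. Given \<open>\<bar>v\<^sub>0\<bar> \<ge> N\<close> and this,
  parallelism at \<open>j\<close> requires \<open>v\<^sub>j = w\<^sub>j = 0\<close> (probability at most \<open>\<sigma>\<^sup>2\<close>) or a nonzero multiple
  \<open>v\<^sub>j\<close> of a number \<open>\<ge> N / m\<close> together with one prescribed value of \<open>w\<^sub>j\<close> (probability at most
  \<open>\<sigma> m / N\<close>). Since \<open>n \<sigma>\<^sup>2 = n\<^sup>2 / l \<rightarrow> 0\<close>, the sum over \<open>j\<close> tends to \<open>0\<close> for suitable \<open>m\<close>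
  and \<open>N\<close>.\<close>

section \<open>The unitriangular filtration and full step\<close>

text \<open>The first \<open>r\<close> superdiagonals vanish, so \<open>r = 0\<close> gives the
  whole group and \<open>r \<ge> n - 1\<close> the trivial one. These sets are the classical lower
  central series of the full unitriangular group, in the indexing of
  \<open>lower_central\<close>.\<close>

definition unitriangular_filtration :: "nat \<Rightarrow> nat \<Rightarrow> int mat set" where
  "unitriangular_filtration n r =
     {A \<in> carrier (unitriangular_group n). \<forall>i k. i < k \<and> k \<le> i + r \<and> k < n \<longrightarrow> A $$ (i, k) = 0}"

lemma unitriangular_group_simps [simp]:
  "mult (unitriangular_group n) = (*)" "\<one>\<^bsub>unitriangular_group n\<^esub> = 1\<^sub>m n"
  by (simp_all add: unitriangular_group_def)

lemma unitriangular_iff: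
  "A \<in> carrier (unitriangular_group n) \<longleftrightarrow> dim_row A = n \<and> dim_col A = n \<and>
     (\<forall>i<n. A $$ (i, i) = 1) \<and> (\<forall>i<n. \<forall>k<i. A $$ (i, k) = 0)"
  by (auto simp: unitriangular_group_def upper_triangular_def)

lemma mat_mult_entry:
  fixes A B :: "int mat"
  assumes "dim_row A = n" "dim_col A = n" "dim_row B = n" "dim_col B = n" "i < n" "k < n"
  shows "(A * B) $$ (i, k) = (\<Sum>t<n. A $$ (i, t) * B $$ (t, k))"
  using assms by (simp add: scalar_prod_def atLeast0LessThan)

lemma unitriangular_mult_entry:
  assumes A: "A \<in> carrier (unitriangular_group n)" and B: "B \<in> carrier (unitriangular_group n)"
    and ik: "i < k" "k < n"
  shows "(A * B) $$ (i, k) = A $$ (i, k) + B $$ (i, k) + (\<Sum>t\<in>{i<..<k}. A $$ (i, t) * B $$ (t, k))"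
proof -
  have "(A * B) $$ (i, k) = (\<Sum>t<n. A $$ (i, t) * B $$ (t, k))"
    using A B ik by (intro mat_mult_entry) (auto simp: unitriangular_iff)
  also have "\<dots> = (\<Sum>t\<in>insert i (insert k {i<..<k}). A $$ (i, t) * B $$ (t, k))"
  proof (rule sum.mono_neutral_right)
    show "\<forall>t\<in>{..<n} - insert i (insert k {i<..<k}). A $$ (i, t) * B $$ (t, k) = 0"
    proof
      fix t assume "t \<in> {..<n} - insert i (insert k {i<..<k})"
      then have "t < i \<or> k < t" "t < n" by auto
      then show "A $$ (i, t) * B $$ (t, k) = 0"
        using A B ik by (auto simp: unitriangular_iff)
    qed
  qed (use ik in auto)
  also have "\<dots> = A $$ (i, k) + B $$ (i, k) + (\<Sum>t\<in>{i<..<k}. A $$ (i, t) * B $$ (t, k))"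
    using A B ik by (simp add: unitriangular_iff)
  finally show ?thesis .
qed

lemma unitriangular_mult_closed:
  assumes A: "A \<in> carrier (unitriangular_group n)" and B: "B \<in> carrier (unitriangular_group n)"
  shows "A * B \<in> carrier (unitriangular_group n)"
proof -
  have e: "(A * B) $$ (i, k) = (\<Sum>t<n. A $$ (i, t) * B $$ (t, k))" if "i < n" "k < n" for i k
    using A B that by (intro mat_mult_entry) (auto simp: unitriangular_iff)
  have "(A * B) $$ (i, i) = 1" if "i < n" for i
  proof -
    have "(\<Sum>t<n. A $$ (i, t) * B $$ (t, i)) = (\<Sum>t\<in>{i}. A $$ (i, t) * B $$ (t, i))"
    proof (rule sum.mono_neutral_right)
      show "\<forall>t\<in>{..<n} - {i}. A $$ (i, t) * B $$ (t, i) = 0"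
      proof
        fix t assume "t \<in> {..<n} - {i}"
        then have "t < i \<or> i < t" "t < n" by auto
        then show "A $$ (i, t) * B $$ (t, i) = 0"
          using A B that by (auto simp: unitriangular_iff)
      qed
    qed (use that in auto)
    then show ?thesis using e[OF that that] A B that by (simp add: unitriangular_iff)
  qed
  moreover have "(A * B) $$ (i, k) = 0" if "i < n" "k < i" for i k
  proof -
    have "(\<Sum>t<n. A $$ (i, t) * B $$ (t, k)) = 0"
    proof (rule sum.neutral, rule ballI)
      fix t assume "t \<in> {..<n}"
      then have "t < i \<or> k < t" "t < n" using that by auto
      then show "A $$ (i, t) * B $$ (t, k) = 0"
        using A B that by (auto simp: unitriangular_iff)
    qed
    then show ?thesis using e[of i k] that by simp
  qed
  ultimately show ?thesis
    using A B by (simp add: unitriangular_iff)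
qed

lemma unitriangular_filtration_0:
  "unitriangular_filtration n 0 = carrier (unitriangular_group n)"
  by (auto simp: unitriangular_filtration_def)

lemma unitriangular_filtration_carrier:
  "A \<in> unitriangular_filtration n r \<Longrightarrow> A \<in> carrier (unitriangular_group n)"
  by (simp add: unitriangular_filtration_def)

lemma unitriangular_filtration_D:
  "A \<in> unitriangular_filtration n r \<Longrightarrow> i < k \<Longrightarrow> k \<le> i + r \<Longrightarrow> k < n \<Longrightarrow> A $$ (i, k) = 0"
  by (simp add: unitriangular_filtration_def)

lemma unitriangular_filtration_SucI:
  assumes "A \<in> unitriangular_filtration n r"
    and "\<And>i. i + Suc r < n \<Longrightarrow> A $$ (i, i + Suc r) = 0"
  shows "A \<in> unitriangular_filtration n (Suc r)"
proof -
  have "A $$ (i, k) = 0" if "i < k" "k \<le> i + Suc r" "k < n" for i k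
  proof (cases "k = i + Suc r")
    case True
    then show ?thesis using assms(2)[of i] that by simp
  next
    case False
    then show ?thesis using unitriangular_filtration_D[OF assms(1)] that by simp
  qed
  then show ?thesis using assms(1) by (simp add: unitriangular_filtration_def)
qed

text \<open>An intermediate index \<open>t\<close> contributes only if it is more than
  \<open>r\<close> away from \<open>i\<close> and more than \<open>s\<close> away from
  \<open>k\<close>. This forces \<open>k \<ge> i + r + s + 2\<close>, so at shorter distance
  multiplication is additive.\<close>

lemma filtration_mult_entry:
  assumes A: "A \<in> unitriangular_filtration n r" and B: "B \<in> unitriangular_filtration n s"
    and "i < k" "k < i + r + s + 2" "k < n"
  shows "(A * B) $$ (i, k) = A $$ (i, k) + B $$ (i, k)"
proof -
  have "(\<Sum>t\<in>{i<..<k}. A $$ (i, t) * B $$ (t, k)) = 0"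
  proof (rule sum.neutral, rule ballI)
    fix t assume t: "t \<in> {i<..<k}"
    then have "t \<le> i + r \<or> k \<le> t + s" using assms by auto
    then show "A $$ (i, t) * B $$ (t, k) = 0"
      using unitriangular_filtration_D[OF A, of i t] unitriangular_filtration_D[OF B, of t k] t assms
      by auto
  qed
  then show ?thesis
    using unitriangular_mult_entry[of A n B i k] A B assms
    by (simp add: unitriangular_filtration_carrier)
qed

text \<open>At the first distance where additivity can fail, exactly one intermediate index escapes
  both vanishing conditions.\<close>

lemma filtration_mult_entry_leading:
  assumes A: "A \<in> unitriangular_filtration n r" and B: "B \<in> unitriangular_filtration n s"
    and k: "k = i + r + s + 2" "k < n"
  shows "(A * B) $$ (i, k) = A $$ (i, k) + B $$ (i, k) + A $$ (i, i + r + 1) * B $$ (i + r + 1, k)"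
proof -
  have "(\<Sum>t\<in>{i<..<k}. A $$ (i, t) * B $$ (t, k)) = (\<Sum>t\<in>{i + r + 1}. A $$ (i, t) * B $$ (t, k))"
  proof (rule sum.mono_neutral_right)
    show "\<forall>t\<in>{i<..<k} - {i + r + 1}. A $$ (i, t) * B $$ (t, k) = 0"
    proof
      fix t assume t: "t \<in> {i<..<k} - {i + r + 1}"
      then have "t \<le> i + r \<or> k \<le> t + s" using k by auto
      then show "A $$ (i, t) * B $$ (t, k) = 0"
        using unitriangular_filtration_D[OF A, of i t] unitriangular_filtration_D[OF B, of t k] t k
        by auto
    qed
  qed (use k in auto)
  then show ?thesis
    using unitriangular_mult_entry[of A n B i k] A B k
    by (simp add: unitriangular_filtration_carrier)
qed

lemma one_in_filtration: "1\<^sub>m n \<in> unitriangular_filtration n r"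
  by (auto simp: unitriangular_filtration_def unitriangular_iff)

lemma filtration_trivial:
  assumes "n \<le> Suc r" shows "unitriangular_filtration n r = {1\<^sub>m n}"
proof -
  have "A = 1\<^sub>m n" if A: "A \<in> unitriangular_filtration n r" for A
  proof (rule eq_matI)
    fix i j assume ij: "i < dim_row (1\<^sub>m n :: int mat)" "j < dim_col (1\<^sub>m n :: int mat)"
    have "i = j \<or> i < j \<or> j < i" by auto
    then show "A $$ (i, j) = 1\<^sub>m n $$ (i, j)"
      using unitriangular_filtration_carrier[OF A] unitriangular_filtration_D[OF A, of i j] ij assms
      by (auto simp: unitriangular_iff)
  qed (use unitriangular_filtration_carrier[OF A] in \<open>simp_all add: unitriangular_iff\<close>)
  then show ?thesis using one_in_filtration by auto
qed

text \<open>Successive approximation: changing the sign of all entries off the diagonal gives a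
  matrix \<open>C\<close> that cancels \<open>A\<close> on superdiagonal \<open>r + 1\<close>. Thus
  \<open>C * A\<close> lies one level deeper, and the induction on \<open>n - r\<close> ends at the
  identity.\<close>

lemma unitriangular_left_inverse:
  assumes "A \<in> unitriangular_filtration n r"
  shows "\<exists>B \<in> carrier (unitriangular_group n). B * A = 1\<^sub>m n"
  using assms
proof (induction "n - r" arbitrary: A r)
  case 0
  then have "A = 1\<^sub>m n" using filtration_trivial[of n r] by auto
  then show ?case using one_in_filtration[of n 0]
    by (auto simp: unitriangular_filtration_0 intro!: bexI[of _ "1\<^sub>m n"])
next
  case (Suc d)
  define C where "C = mat n n (\<lambda>(i, k). if i = k then 1 else - A $$ (i, k))"
  have A: "A \<in> carrier (unitriangular_group n)"
    using Suc.prems by (rule unitriangular_filtration_carrier)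
  have C: "C \<in> unitriangular_filtration n r"
    using Suc.prems by (auto simp: unitriangular_filtration_def unitriangular_iff C_def)
  have CA: "C * A \<in> carrier (unitriangular_group n)"
    using A unitriangular_filtration_carrier[OF C] by (rule unitriangular_mult_closed[rotated])
  have ent: "(C * A) $$ (i, k) = 0" if "i < k" "k \<le> i + Suc r" "k < n" for i k
    using filtration_mult_entry[OF C Suc.prems, of i k] that by (auto simp: C_def)
  have "C * A \<in> unitriangular_filtration n (Suc r)"
    using CA ent by (simp add: unitriangular_filtration_def)
  moreover have "d = n - Suc r" using Suc.hyps(2) by linarith
  ultimately obtain B where B: "B \<in> carrier (unitriangular_group n)" "B * (C * A) = 1\<^sub>m n"
    using Suc.hyps(1)[of "Suc r" "C * A"] by blast
  have "(B * C) * A = 1\<^sub>m n"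
    using B A unitriangular_filtration_carrier[OF C]
    by (subst assoc_mult_mat[of _ n n _ n _ n]) (auto simp: unitriangular_iff)
  then show ?case
    using B unitriangular_filtration_carrier[OF C]
    by (intro bexI[of _ "B * C"]) (auto intro: unitriangular_mult_closed)
qed

lemma group_unitriangular_group: "group (unitriangular_group n)"
proof (rule groupI)
  fix x y z assume "x \<in> carrier (unitriangular_group n)" "y \<in> carrier (unitriangular_group n)"
    "z \<in> carrier (unitriangular_group n)"
  then show "x \<otimes>\<^bsub>unitriangular_group n\<^esub> y \<otimes>\<^bsub>unitriangular_group n\<^esub> z =
      x \<otimes>\<^bsub>unitriangular_group n\<^esub> (y \<otimes>\<^bsub>unitriangular_group n\<^esub> z)"
    by (auto simp: unitriangular_iff intro!: assoc_mult_mat[of _ n n _ n _ n])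
next
  fix x assume "x \<in> carrier (unitriangular_group n)"
  then show "\<exists>y\<in>carrier (unitriangular_group n). y \<otimes>\<^bsub>unitriangular_group n\<^esub> x = \<one>\<^bsub>unitriangular_group n\<^esub>"
    using unitriangular_left_inverse[of x n 0] by (simp add: unitriangular_filtration_0)
next
  fix x assume "x \<in> carrier (unitriangular_group n)"
  then show "\<one>\<^bsub>unitriangular_group n\<^esub> \<otimes>\<^bsub>unitriangular_group n\<^esub> x = x"
    by (auto simp: unitriangular_iff intro!: left_mult_one_mat)
next
  show "\<one>\<^bsub>unitriangular_group n\<^esub> \<in> carrier (unitriangular_group n)"
    using one_in_filtration[of n 0] by (simp add: unitriangular_filtration_0)
qed (use unitriangular_mult_closed in simp)

lemma subgroup_filtration: "subgroup (unitriangular_filtration n r) (unitriangular_group n)"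
proof -
  interpret U: group "unitriangular_group n" by (rule group_unitriangular_group)
  show ?thesis
  proof (rule U.subgroupI)
    show "unitriangular_filtration n r \<subseteq> carrier (unitriangular_group n)"
      by (auto intro: unitriangular_filtration_carrier)
    show "unitriangular_filtration n r \<noteq> {}" using one_in_filtration by blast
  next
    fix A B assume AB: "A \<in> unitriangular_filtration n r" "B \<in> unitriangular_filtration n r"
    then have "(A * B) $$ (i, k) = 0" if "i < k" "k \<le> i + r" "k < n" for i k
      using filtration_mult_entry[OF AB, of i k] that unitriangular_filtration_D by fastforce
    then show "A \<otimes>\<^bsub>unitriangular_group n\<^esub> B \<in> unitriangular_filtration n r"
      using AB by (auto simp: unitriangular_filtration_def intro: unitriangular_mult_closed)
  next
    fix A assume A: "A \<in> unitriangular_filtration n r"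
    then have cA: "A \<in> carrier (unitriangular_group n)" by (rule unitriangular_filtration_carrier)
    define B where "B = inv\<^bsub>unitriangular_group n\<^esub> A"
    have AB: "A * B = 1\<^sub>m n" and cB: "B \<in> carrier (unitriangular_group n)"
      using U.r_inv[OF cA] U.inv_closed[OF cA] by (simp_all add: B_def)
    \<comment> \<open>The inverse climbs one level at a time: once \<open>B\<close> is in level
      \<open>s\<close>, the entries of \<open>A * B = 1\<close> at distance \<open>s + 1\<close> are
      sums, and the summand from \<open>A\<close> is zero as long as
      \<open>s + 1 \<le> r\<close>.\<close>
    have "B \<in> unitriangular_filtration n s" if "s \<le> r" for s
      using that
    proof (induction s)
      case 0
      then show ?case using cB by (simp add: unitriangular_filtration_0)
    next
      case (Suc s)
      show ?case
      proof (rule unitriangular_filtration_SucI)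
        show B: "B \<in> unitriangular_filtration n s" using Suc by simp
        fix i assume i: "i + Suc s < n"
        show "B $$ (i, i + Suc s) = 0"
          using filtration_mult_entry[OF A B, of i "i + Suc s"] i Suc.prems AB
            unitriangular_filtration_D[OF A, of i "i + Suc s"] by simp
      qed
    qed
    then show "inv\<^bsub>unitriangular_group n\<^esub> A \<in> unitriangular_filtration n r"
      by (simp add: B_def)
  qed
qed

text \<open>The recursion for the leading diagonal comes from comparing both sides of
  \<open>c (k h) = h k\<close> for the commutator \<open>c = h k h\<^sup>-\<^sup>1 k\<^sup>-\<^sup>1\<close>.\<close>

lemma commutator_filtration:
  fixes n
  defines "U \<equiv> unitriangular_group n"
  assumes h: "h \<in> carrier U" and k: "k \<in> unitriangular_filtration n r"
  defines "c \<equiv> h \<otimes>\<^bsub>U\<^esub> k \<otimes>\<^bsub>U\<^esub> inv\<^bsub>U\<^esub> h \<otimes>\<^bsub>U\<^esub> inv\<^bsub>U\<^esub> k"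
  shows "c \<in> unitriangular_filtration n (Suc r)"
    and "\<And>i. i + r + 2 < n \<Longrightarrow>
      c $$ (i, i + r + 2) = h $$ (i, i + 1) * k $$ (i + 1, i + r + 2) - k $$ (i, i + r + 1) * h $$ (i + r + 1, i + r + 2)"
proof -
  interpret U: group U unfolding U_def by (rule group_unitriangular_group)
  have k': "k \<in> carrier U" using k unfolding U_def by (rule unitriangular_filtration_carrier)
  have c: "c \<in> carrier U" using h k' by (simp add: c_def)
  have "c \<otimes>\<^bsub>U\<^esub> (k \<otimes>\<^bsub>U\<^esub> h) = h \<otimes>\<^bsub>U\<^esub> k"
    using h k' by (simp add: c_def U.m_assoc U.inv_solve_left')
  then have eq: "c * (k * h) = h * k" by (simp add: U_def)
  have h0: "h \<in> unitriangular_filtration n 0" using h by (simp add: U_def unitriangular_filtration_0)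
  have kh0: "k * h \<in> unitriangular_filtration n 0"
    using h k' by (simp add: U_def unitriangular_filtration_0 unitriangular_mult_closed)
  have hk: "(h * k) $$ (i, j) = h $$ (i, j) + k $$ (i, j)" "(k * h) $$ (i, j) = h $$ (i, j) + k $$ (i, j)"
    if "i < j" "j \<le> i + Suc r" "j < n" for i j
    using filtration_mult_entry[OF h0 k, of i j] filtration_mult_entry[OF k h0, of i j] that by auto
  \<comment> \<open>The same climb for \<open>c\<close>: up to distance \<open>r + 1\<close> the
    entries of \<open>h * k\<close> and \<open>k * h\<close> agree, so additivity in
    \<open>c * (k * h) = h * k\<close> leaves zero for \<open>c\<close>.\<close>
  have "c \<in> unitriangular_filtration n s" if "s \<le> Suc r" for s
    using that
  proof (induction s)
    case 0
    then show ?case using c by (simp add: U_def unitriangular_filtration_0)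
  next
    case (Suc s)
    show ?case
    proof (rule unitriangular_filtration_SucI)
      show C: "c \<in> unitriangular_filtration n s" using Suc by simp
      fix i assume i: "i + Suc s < n"
      show "c $$ (i, i + Suc s) = 0"
        using filtration_mult_entry[OF C kh0, of i "i + Suc s"] i Suc.prems eq
          hk[of i "i + Suc s"] by simp
    qed
  qed
  then show C: "c \<in> unitriangular_filtration n (Suc r)" by simp
  fix i assume i: "i + r + 2 < n"
  show "c $$ (i, i + r + 2) = h $$ (i, i + 1) * k $$ (i + 1, i + r + 2) - k $$ (i, i + r + 1) * h $$ (i + r + 1, i + r + 2)"
    using filtration_mult_entry[OF C kh0, of i "i + r + 2"] i eq
      filtration_mult_entry_leading[OF h0 k, of "i + r + 2" i]
      filtration_mult_entry_leading[OF k h0, of "i + r + 2" i] by simp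
qed

section \<open>Superdiagonal homomorphisms and the length of the lower central series\<close>

lemma superdiagonal_mult:
  assumes "A \<in> carrier (unitriangular_group n)" "B \<in> carrier (unitriangular_group n)" "Suc i < n"
  shows "(A * B) $$ (i, Suc i) = A $$ (i, Suc i) + B $$ (i, Suc i)"
  using filtration_mult_entry[of A n 0 B 0 i "Suc i"] assms by (simp add: unitriangular_filtration_0)

text \<open>At distance one there is no intermediate index. These coordinates of the abelianization
  turn powers into multiples, and matrix walks into walks on the integers.\<close>

lemma superdiagonal_hom:
  assumes "Suc i < n"
  shows "group_hom (unitriangular_group n) integer_group (\<lambda>A. A $$ (i, Suc i))"
proof (intro group_hom.intro group_unitriangular_group group_hom_axioms.intro homI)
  show "group integer_group" by simp
qed (use assms superdiagonal_mult in auto)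

lemma superdiagonal_int_pow:
  assumes "A \<in> carrier (unitriangular_group n)" "Suc i < n"
  shows "(A [^]\<^bsub>unitriangular_group n\<^esub> (z::int)) $$ (i, Suc i) = z * A $$ (i, Suc i)"
  using group_hom.hom_int_pow[OF superdiagonal_hom[OF assms(2)] assms(1), of z] by simp

text \<open>This serves twice: level \<open>n - 1\<close> is trivial, which bounds the step from
  above, and membership in level \<open>r\<close> is what the formula for the leading entry of a
  commutator requires.\<close>

lemma lower_central_subset_filtration:
  fixes n S
  defines "G \<equiv> subgroup_generated (unitriangular_group n) S"
  shows "lower_central G r \<subseteq> carrier G \<inter> unitriangular_filtration n r"
proof -
  interpret U: group "unitriangular_group n" by (rule group_unitriangular_group)
  interpret G: group G unfolding G_def by (rule U.group_subgroup_generated)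
  have carG: "carrier G \<subseteq> carrier (unitriangular_group n)"
    unfolding G_def by (rule U.carrier_subgroup_generated_subset)
  show ?thesis
  proof (induction r)
    case 0
    then show ?case using carG by (auto simp: unitriangular_filtration_0)
  next
    case (Suc r)
    have sub: "subgroup (carrier G \<inter> unitriangular_filtration n (Suc r)) G"
    proof (rule G.subgroupI)
      show "carrier G \<inter> unitriangular_filtration n (Suc r) \<noteq> {}"
        using one_in_filtration[of n "Suc r"] G.one_closed by (auto simp: G_def)
    next
      fix a assume "a \<in> carrier G \<inter> unitriangular_filtration n (Suc r)"
      then show "inv\<^bsub>G\<^esub> a \<in> carrier G \<inter> unitriangular_filtration n (Suc r)"
        using U.inv_subgroup_generated[of a S] subgroup.m_inv_closed[OF subgroup_filtration, of a n "Suc r"]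
          G.inv_closed[of a]
        by (auto simp flip: G_def)
    next
      fix a b assume "a \<in> carrier G \<inter> unitriangular_filtration n (Suc r)"
        "b \<in> carrier G \<inter> unitriangular_filtration n (Suc r)"
      then show "a \<otimes>\<^bsub>G\<^esub> b \<in> carrier G \<inter> unitriangular_filtration n (Suc r)"
        using subgroup.m_closed[OF subgroup_filtration, of a n "Suc r" b] G.m_closed[of a b]
        by (auto simp: G_def)
    qed simp
    show ?case
      unfolding lower_central.simps commutator_subgroup_def
    proof (rule G.generate_subgroup_incl[OF _ sub], safe)
      fix h k assume h: "h \<in> carrier G" and k: "k \<in> lower_central G r"
      have kG: "k \<in> carrier G" and kr: "k \<in> unitriangular_filtration n r" using k Suc by auto
      show "h \<otimes>\<^bsub>G\<^esub> k \<otimes>\<^bsub>G\<^esub> inv\<^bsub>G\<^esub> h \<otimes>\<^bsub>G\<^esub> inv\<^bsub>G\<^esub> k \<in> carrier G"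
        using h kG by simp
      have "inv\<^bsub>G\<^esub> h = inv\<^bsub>unitriangular_group n\<^esub> h" "inv\<^bsub>G\<^esub> k = inv\<^bsub>unitriangular_group n\<^esub> k"
        using h kG U.inv_subgroup_generated[of _ S] by (auto simp flip: G_def)
      then show "h \<otimes>\<^bsub>G\<^esub> k \<otimes>\<^bsub>G\<^esub> inv\<^bsub>G\<^esub> h \<otimes>\<^bsub>G\<^esub> inv\<^bsub>G\<^esub> k \<in> unitriangular_filtration n (Suc r)"
        using commutator_filtration(1)[of h n k r] h carG kr by (auto simp: G_def)
    qed
  qed
qed

text \<open>Iterated commutators with \<open>x\<close>, whose first superdiagonal entry vanishes, only ever
  multiply the top-left leading entry by a further superdiagonal entry of \<open>x\<close>.\<close>

lemma lower_central_leading_entry: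
  fixes n S
  defines "G \<equiv> subgroup_generated (unitriangular_group n) S"
  assumes x: "x \<in> carrier G" and y: "y \<in> carrier G"
    and x0: "x $$ (0, 1) = 0" and y0: "y $$ (0, 1) \<noteq> 0"
    and xj: "\<And>j. 1 \<le> j \<Longrightarrow> Suc j < n \<Longrightarrow> x $$ (j, Suc j) \<noteq> 0"
  shows "Suc r < n \<Longrightarrow> \<exists>k\<in>lower_central G r. k $$ (0, Suc r) \<noteq> 0"
proof (induction r)
  case 0
  then show ?case using y y0 by auto
next
  case (Suc r)
  interpret U: group "unitriangular_group n" by (rule group_unitriangular_group)
  have carG: "carrier G \<subseteq> carrier (unitriangular_group n)"
    unfolding G_def by (rule U.carrier_subgroup_generated_subset)
  obtain k where k: "k \<in> lower_central G r" "k $$ (0, Suc r) \<noteq> 0" using Suc by auto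
  have kG: "k \<in> carrier G" and kr: "k \<in> unitriangular_filtration n r"
    using k(1) lower_central_subset_filtration[of n S r] by (auto simp: G_def)
  define c where "c = x \<otimes>\<^bsub>G\<^esub> k \<otimes>\<^bsub>G\<^esub> inv\<^bsub>G\<^esub> x \<otimes>\<^bsub>G\<^esub> inv\<^bsub>G\<^esub> k"
  have "inv\<^bsub>G\<^esub> x = inv\<^bsub>unitriangular_group n\<^esub> x" "inv\<^bsub>G\<^esub> k = inv\<^bsub>unitriangular_group n\<^esub> k"
    using x kG U.inv_subgroup_generated[of _ S] by (auto simp flip: G_def)
  then have "c $$ (0, Suc (Suc r)) = - k $$ (0, Suc r) * x $$ (Suc r, Suc (Suc r))"
    using commutator_filtration(2)[of x n k r 0] x carG kr Suc.prems x0
    by (auto simp: c_def G_def)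
  then have "c $$ (0, Suc (Suc r)) \<noteq> 0" using k(2) xj[of "Suc r"] Suc.prems by simp
  moreover have "c \<in> lower_central G (Suc r)"
    unfolding lower_central.simps commutator_subgroup_def c_def
    using x k(1) by (intro generate.incl) blast
  ultimately show ?case by blast
qed

text \<open>Through this, nontriviality of the single term \<open>n - 2\<close> rules out every
  index below \<open>n - 1\<close> as the least one.\<close>

lemma (in group) lower_central_trivial_mono:
  assumes "lower_central G r = {\<one>}" "r \<le> s"
  shows "lower_central G s = {\<one>}"
  using assms(2)
proof (induction s rule: dec_induct)
  case (step s)
  have "(\<Union>h\<in>carrier G. \<Union>k\<in>lower_central G s. {h \<otimes> k \<otimes> inv h \<otimes> inv k}) = {\<one>}"
    using step.IH by (auto intro!: bexI[of _ \<one>])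
  then show ?case by (simp add: commutator_subgroup_def generate_one)
qed (use assms in simp)

lemma full_step_criterion:
  assumes n: "2 \<le> n"
    and V: "V \<in> carrier (unitriangular_group n)" and W: "W \<in> carrier (unitriangular_group n)"
    and V0: "V $$ (0, 1) \<noteq> 0"
    and VW: "\<And>j. 1 \<le> j \<Longrightarrow> Suc j < n \<Longrightarrow>
      V $$ (0, 1) * W $$ (j, Suc j) \<noteq> W $$ (0, 1) * V $$ (j, Suc j)"
  shows "nilpotency_step (subgroup_generated (unitriangular_group n) {V, W}) = n - 1"
proof -
  interpret U: group "unitriangular_group n" by (rule group_unitriangular_group)
  define G where "G = subgroup_generated (unitriangular_group n) {V, W}"
  interpret G: group G unfolding G_def by (rule U.group_subgroup_generated)
  have VG: "V \<in> carrier G" and WG: "W \<in> carrier G"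
    unfolding G_def carrier_subgroup_generated using V W by (auto intro: generate.incl)
  define Va where "Va = V [^]\<^bsub>unitriangular_group n\<^esub> (- W $$ (0, 1))"
  define Wa where "Wa = W [^]\<^bsub>unitriangular_group n\<^esub> (V $$ (0, 1))"
  define x where "x = Va * Wa"
  have aG: "Va \<in> carrier G" "Wa \<in> carrier G"
    using G.int_pow_closed[OF VG] G.int_pow_closed[OF WG]
      U.int_pow_subgroup_generated[of V "{V, W}"] U.int_pow_subgroup_generated[of W "{V, W}"] VG WG
    by (auto simp: Va_def Wa_def G_def)
  have aU: "Va \<in> carrier (unitriangular_group n)" "Wa \<in> carrier (unitriangular_group n)"
    using V W by (simp_all add: Va_def Wa_def)
  have xG: "x \<in> carrier G"
    using G.m_closed[OF aG] by (simp add: x_def G_def)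
  have xe: "x $$ (j, Suc j) = V $$ (0, 1) * W $$ (j, Suc j) - W $$ (0, 1) * V $$ (j, Suc j)"
    if "Suc j < n" for j
    using superdiagonal_mult[OF aU that] superdiagonal_int_pow[OF V that] superdiagonal_int_pow[OF W that]
    by (simp add: x_def Va_def Wa_def)
  \<comment> \<open>Term \<open>n - 2\<close> has its leading entries at distance
    \<open>n - 1\<close>, and the only such position is the top-right corner.\<close>
  have "\<exists>k\<in>lower_central G (n - 2). k $$ (0, Suc (n - 2)) \<noteq> 0"
    unfolding G_def
  proof (rule lower_central_leading_entry)
    show "x $$ (0, 1) = 0" using xe[of 0] n by simp
    show "x $$ (j, Suc j) \<noteq> 0" if "1 \<le> j" "Suc j < n" for j using xe VW that by simp
  qed (use xG VG V0 n in \<open>simp_all add: G_def\<close>)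
  then obtain k where k: "k \<in> lower_central G (n - 2)" "k $$ (0, Suc (n - 2)) \<noteq> 0" by blast
  have nontriv: "lower_central G (n - 2) \<noteq> {\<one>\<^bsub>G\<^esub>}"
  proof
    assume "lower_central G (n - 2) = {\<one>\<^bsub>G\<^esub>}"
    then have "k = 1\<^sub>m n" using k(1) by (simp add: G_def)
    then show False using k(2) n by simp
  qed
  have "lower_central G (n - 1) \<subseteq> {\<one>\<^bsub>G\<^esub>}"
    using lower_central_subset_filtration[of n "{V, W}" "n - 1"] filtration_trivial[of n "n - 1"]
    by (auto simp: G_def)
  moreover have "\<one>\<^bsub>G\<^esub> \<in> lower_central G (n - 1)"
    using n by (cases "n - 1") (auto simp: commutator_subgroup_def intro: generate.one)
  ultimately have triv: "lower_central G (n - 1) = {\<one>\<^bsub>G\<^esub>}" by blast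
  have "n - 1 \<le> r" if "lower_central G r = {\<one>\<^bsub>G\<^esub>}" for r
    using G.lower_central_trivial_mono[OF that, of "n - 2"] nontriv by linarith
  then show ?thesis
    unfolding nilpotency_step_def G_def[symmetric] using triv by (intro Least_equality)
qed

section \<open>Laws of superdiagonal entries\<close>

lemma elementary_unitriangular_carrier:
  "elementary_unitriangular n i \<in> carrier (unitriangular_group n)"
  by (auto simp: elementary_unitriangular_def unitriangular_iff)

lemma superdiagonal_elementary:
  "Suc k < n \<Longrightarrow> elementary_unitriangular n i $$ (k, Suc k) = of_bool (k = i)"
  by (auto simp: elementary_unitriangular_def)

lemma superdiagonal_inv_elementary:
  assumes "Suc k < n"
  shows "(inv\<^bsub>unitriangular_group n\<^esub> elementary_unitriangular n i) $$ (k, Suc k) = - of_bool (k = i)"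
  using group_hom.hom_inv[OF superdiagonal_hom[OF assms] elementary_unitriangular_carrier, of i]
    superdiagonal_elementary[OF assms, of i] by simp

lemma standard_generators_subset: "standard_generators n \<subseteq> carrier (unitriangular_group n)"
  using group.inv_closed[OF group_unitriangular_group elementary_unitriangular_carrier]
  by (auto simp: standard_generators_def elementary_unitriangular_carrier)

lemma finite_standard_generators: "finite (standard_generators n)"
proof -
  have "{i. Suc i < n} = {..<n - 1}" by auto
  then show ?thesis by (simp add: standard_generators_def)
qed

lemma standard_generators_nonempty: "2 \<le> n \<Longrightarrow> standard_generators n \<noteq> {}"
  by (auto simp: standard_generators_def intro!: exI[of _ 0])

text \<open>The superdiagonals distinguish all generators and their inverses, so the uniform law on
  the set is the uniform law on signed indices, without collisions.\<close>

lemma sum_standard_generators: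
  fixes f :: "int mat \<Rightarrow> 'a :: comm_monoid_add"
  shows "(\<Sum>g\<in>standard_generators n. f g) =
    (\<Sum>i<n - 1. f (elementary_unitriangular n i) +
       f (inv\<^bsub>unitriangular_group n\<^esub> elementary_unitriangular n i))"
proof -
  define E where "E = elementary_unitriangular n"
  define E' where "E' = (\<lambda>i. inv\<^bsub>unitriangular_group n\<^esub> elementary_unitriangular n i)"
  have S: "standard_generators n = E ` {..<n - 1} \<union> E' ` {..<n - 1}"
    unfolding standard_generators_def E_def E'_def less_diff_conv lessThan_def by auto
  have E: "E i $$ (k, Suc k) = of_bool (k = i)" if "k < n - 1" for i k
    using superdiagonal_elementary[of k n i] that by (simp add: E_def)
  have E': "E' i $$ (k, Suc k) = - of_bool (k = i)" if "k < n - 1" for i k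
    using superdiagonal_inv_elementary[of k n i] that by (simp add: E'_def)
  have inj: "inj_on E {..<n - 1}" "inj_on E' {..<n - 1}"
  proof (rule inj_onI)
    fix i j assume "i \<in> {..<n - 1}" "j \<in> {..<n - 1}" "E i = E j"
    then show "i = j" using E[of i i] E[of i j] by auto
  next
    show "inj_on E' {..<n - 1}"
    proof (rule inj_onI)
      fix i j assume "i \<in> {..<n - 1}" "j \<in> {..<n - 1}" "E' i = E' j"
      then show "i = j" using E'[of i i] E'[of i j] by auto
    qed
  qed
  have "E i \<noteq> E' j" if "i < n - 1" "j < n - 1" for i j
  proof
    assume "E i = E' j"
    then have "E i $$ (i, Suc i) = E' j $$ (i, Suc i)" by simp
    then show False using E[of i i] E'[of i j] that by (cases "i = j") auto
  qed
  then have "E ` {..<n - 1} \<inter> E' ` {..<n - 1} = {}" by auto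
  then have "(\<Sum>g\<in>standard_generators n. f g) = (\<Sum>i<n - 1. f (E i)) + (\<Sum>i<n - 1. f (E' i))"
    unfolding S using inj by (simp add: sum.union_disjoint sum.reindex)
  then show ?thesis by (simp add: sum.distrib E_def E'_def)
qed

lemma card_standard_generators: "card (standard_generators n) = 2 * (n - 1)"
  using sum_standard_generators[of "\<lambda>_. 1 :: nat" n] by simp

section \<open>Support and one-step recursion of the random walk\<close>

lemma set_random_walk:
  assumes "2 \<le> n"
  shows "set_pmf (random_walk n l) \<subseteq> carrier (unitriangular_group n)"
proof -
  have "foldr (mult (unitriangular_group n)) Vs \<one>\<^bsub>unitriangular_group n\<^esub> \<in> carrier (unitriangular_group n)"
    if "set Vs \<subseteq> carrier (unitriangular_group n)" for Vs
    using that
  proof (induction Vs)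
    case Nil
    then show ?case using monoid.one_closed[OF group.is_monoid[OF group_unitriangular_group]] by simp
  next
    case (Cons g Vs)
    then show ?case by (auto intro: unitriangular_mult_closed)
  qed
  then show ?thesis
    using standard_generators_subset[of n] assms
    by (auto simp: random_walk_def set_replicate_pmf set_pmf_of_set finite_standard_generators
        standard_generators_nonempty)
qed

lemma finite_set_random_walk:
  assumes "2 \<le> n"
  shows "finite (set_pmf (random_walk n l))"
  using assms finite_lists_length_eq[OF finite_standard_generators, of n l]
  by (auto simp: random_walk_def set_replicate_pmf set_pmf_of_set finite_standard_generators
      standard_generators_nonempty in_lists_conv_set subset_iff
      intro!: finite_imageI elim!: rev_finite_subset)

lemma map_random_walk_0: "map_pmf \<phi> (random_walk n 0) = return_pmf (\<phi> (1\<^sub>m n))"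
  by (simp add: random_walk_def)

text \<open>Conditioning on the first factor. An additive \<open>\<phi>\<close> shifts the law of
  the remaining product by the value on that factor; the general target group covers both one entry
  and a pair of entries.\<close>

lemma pmf_map_random_walk_Suc:
  fixes \<phi> :: "int mat \<Rightarrow> 'b :: ab_group_add"
  assumes n: "2 \<le> n"
    and add: "\<And>A B. A \<in> carrier (unitriangular_group n) \<Longrightarrow> B \<in> carrier (unitriangular_group n) \<Longrightarrow>
      \<phi> (A * B) = \<phi> A + \<phi> B"
  shows "pmf (map_pmf \<phi> (random_walk n (Suc l))) z =
    (\<Sum>i<n - 1. pmf (map_pmf \<phi> (random_walk n l)) (z - \<phi> (elementary_unitriangular n i)) +
       pmf (map_pmf \<phi> (random_walk n l)) (z + \<phi> (elementary_unitriangular n i))) / (2 * (real n - 1))"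
proof -
  let ?U = "unitriangular_group n" and ?S = "standard_generators n"
  interpret U: group ?U by (rule group_unitriangular_group)
  have inv: "\<phi> (inv\<^bsub>?U\<^esub> A) = - \<phi> A" if A: "A \<in> carrier ?U" for A
  proof -
    have "\<phi> (1\<^sub>m n) = \<phi> (1\<^sub>m n) + \<phi> (1\<^sub>m n)"
      using add[OF U.one_closed U.one_closed] by simp
    then have "\<phi> (1\<^sub>m n) = 0" by simp
    moreover have "\<phi> (inv\<^bsub>?U\<^esub> A) + \<phi> A = \<phi> (1\<^sub>m n)"
      using add[OF U.inv_closed[OF A] A] U.l_inv[OF A] by simp
    ultimately show ?thesis by (simp add: eq_neg_iff_add_eq_0)
  qed
  have "map_pmf \<phi> (random_walk n (Suc l)) =
    bind_pmf (pmf_of_set ?S) (\<lambda>g. map_pmf (\<lambda>V. \<phi> (g * V)) (random_walk n l))"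
    by (simp add: random_walk_def map_bind_pmf map_pmf_comp map_pmf_def bind_assoc_pmf bind_return_pmf)
  also have "\<dots> = bind_pmf (pmf_of_set ?S) (\<lambda>g. map_pmf (\<lambda>x. \<phi> g + x) (map_pmf \<phi> (random_walk n l)))"
  proof (rule bind_pmf_cong[OF refl])
    fix g assume "g \<in> set_pmf (pmf_of_set ?S)"
    then have g: "g \<in> carrier ?U"
      using standard_generators_subset n finite_standard_generators standard_generators_nonempty
      by (auto simp: set_pmf_of_set)
    show "map_pmf (\<lambda>V. \<phi> (g * V)) (random_walk n l) =
        map_pmf (\<lambda>x. \<phi> g + x) (map_pmf \<phi> (random_walk n l))"
      using set_random_walk[OF n] by (auto simp: map_pmf_comp intro!: map_pmf_cong add g)
  qed
  finally have "pmf (map_pmf \<phi> (random_walk n (Suc l))) z =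
      (\<Sum>g\<in>?S. pmf (map_pmf (\<lambda>x. \<phi> g + x) (map_pmf \<phi> (random_walk n l))) z) / card ?S"
    using n finite_standard_generators standard_generators_nonempty
    by (simp add: pmf_bind_pmf_of_set)
  also have "(\<Sum>g\<in>?S. pmf (map_pmf (\<lambda>x. \<phi> g + x) (map_pmf \<phi> (random_walk n l))) z) =
      (\<Sum>g\<in>?S. pmf (map_pmf \<phi> (random_walk n l)) (z - \<phi> g))"
  proof (rule sum.cong[OF refl])
    fix g
    show "pmf (map_pmf (\<lambda>x. \<phi> g + x) (map_pmf \<phi> (random_walk n l))) z =
        pmf (map_pmf \<phi> (random_walk n l)) (z - \<phi> g)"
      using pmf_map_inj'[of "\<lambda>x. \<phi> g + x" "map_pmf \<phi> (random_walk n l)" "z - \<phi> g"]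
      by (simp add: inj_def)
  qed
  also have "\<dots> = (\<Sum>i<n - 1. pmf (map_pmf \<phi> (random_walk n l)) (z - \<phi> (elementary_unitriangular n i)) +
       pmf (map_pmf \<phi> (random_walk n l)) (z + \<phi> (elementary_unitriangular n i)))"
    by (simp add: sum_standard_generators inv[OF elementary_unitriangular_carrier])
  finally show ?thesis using n by (simp add: card_standard_generators of_nat_diff)
qed

section \<open>Recursions for one and for two superdiagonal entries\<close>

definition superdiagonal_law :: "nat \<Rightarrow> nat \<Rightarrow> nat \<Rightarrow> int pmf" where
  "superdiagonal_law n i l = map_pmf (\<lambda>V. V $$ (i, Suc i)) (random_walk n l)"

text \<open>Two entries of the same walk are dependent, since one step moves at most one of them;
  hence the joint law is followed directly.\<close>

definition superdiagonal_joint_law :: "nat \<Rightarrow> nat \<Rightarrow> nat \<Rightarrow> nat \<Rightarrow> (int \<times> int) pmf" where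
  "superdiagonal_joint_law n i j l = map_pmf (\<lambda>V. (V $$ (i, Suc i), V $$ (j, Suc j))) (random_walk n l)"

lemma sum_of_bool_single:
  fixes f :: "bool \<Rightarrow> real"
  assumes "i < m"
  shows "(\<Sum>k<m. f (i = k)) = f True + (real m - 1) * f False"
proof -
  have "(\<Sum>k<m. f (i = k)) = (\<Sum>k\<in>insert i ({..<m} - {i}). f (i = k))"
    using assms by (intro sum.cong) auto
  also have "\<dots> = f True + (\<Sum>k\<in>{..<m} - {i}. f (i = k))" by (subst sum.insert) auto
  also have "(\<Sum>k\<in>{..<m} - {i}. f (i = k)) = (\<Sum>k\<in>{..<m} - {i}. f False)"
    by (intro sum.cong) auto
  finally show ?thesis using assms by (simp add: of_nat_diff)
qed

lemma sum_of_bool_pair: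
  fixes f :: "bool \<Rightarrow> bool \<Rightarrow> real"
  assumes "i < m" "j < m" "i \<noteq> j"
  shows "(\<Sum>k<m. f (i = k) (j = k)) = f True False + f False True + (real m - 2) * f False False"
proof -
  have "(\<Sum>k<m. f (i = k) (j = k)) = (\<Sum>k\<in>insert i (insert j ({..<m} - {i, j})). f (i = k) (j = k))"
    using assms by (intro sum.cong) auto
  also have "\<dots> = f True False + f False True + (\<Sum>k\<in>{..<m} - {i, j}. f (i = k) (j = k))"
    using assms by simp
  also have "(\<Sum>k\<in>{..<m} - {i, j}. f (i = k) (j = k)) = (\<Sum>k\<in>{..<m} - {i, j}. f False False)"
    by (intro sum.cong) auto
  also have "\<dots> = (real m - 2) * f False False"
  proof -
    have "card {i, j} = 2" "card {i, j} \<le> m" using assms card_mono[of "{..<m}" "{i, j}"] by auto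
    then show ?thesis using assms by (simp add: card_Diff_subset of_nat_diff)
  qed
  finally show ?thesis .
qed

lemma pmf_superdiagonal_law_0: "Suc i < n \<Longrightarrow> pmf (superdiagonal_law n i 0) x = of_bool (x = 0)"
  by (simp add: superdiagonal_law_def map_random_walk_0 indicator_def)

text \<open>\<open>q\<close> is the probability of one given generator. Only two generators move the
  entry, by plus or minus one.\<close>

lemma pmf_superdiagonal_law_Suc:
  assumes "Suc i < n"
  defines "q \<equiv> 1 / (2 * (real n - 1))"
  shows "pmf (superdiagonal_law n i (Suc l)) x =
    (1 - 2 * q) * pmf (superdiagonal_law n i l) x +
    q * (pmf (superdiagonal_law n i l) (x - 1) + pmf (superdiagonal_law n i l) (x + 1))"
proof -
  let ?f = "pmf (superdiagonal_law n i l)"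
  have "pmf (superdiagonal_law n i (Suc l)) x =
     (\<Sum>k<n - 1. ?f (x - of_bool (i = k)) + ?f (x + of_bool (i = k))) / (2 * (real n - 1))"
    unfolding superdiagonal_law_def
    using assms by (subst pmf_map_random_walk_Suc)
      (auto intro: superdiagonal_mult simp: superdiagonal_elementary)
  also have "\<dots> = q * ((?f (x - 1) + ?f (x + 1)) + (real (n - 1) - 1) * (2 * ?f x))"
    using assms by (subst sum_of_bool_single[where f = "\<lambda>b. ?f (x - of_bool b) + ?f (x + of_bool b)"]) (auto simp: q_def)
  finally have "pmf (superdiagonal_law n i (Suc l)) x =
      q * ((?f (x - 1) + ?f (x + 1)) + (real (n - 1) - 1) * (2 * ?f x))" .
  moreover have "q * (2 * (real n - 1)) * ?f x = ?f x" "real (n - 1) = real n - 1"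
    using assms(1) by (simp_all add: q_def of_nat_diff)
  ultimately show ?thesis by (simp add: algebra_simps)
qed

lemma pmf_superdiagonal_joint_law_0:
  "Suc i < n \<Longrightarrow> Suc j < n \<Longrightarrow>
    pmf (superdiagonal_joint_law n i j 0) (x, y) = of_bool (x = 0 \<and> y = 0)"
  by (simp add: superdiagonal_joint_law_def map_random_walk_0 indicator_def)

text \<open>Four generators act, each on one coordinate. The terms are grouped so that, for fixed
  \<open>x\<close>, the first two form a lazy step in \<open>y\<close> and the last is a nonnegative
  combination of neighbouring rows.\<close>

lemma pmf_superdiagonal_joint_law_Suc:
  fixes n i j l :: nat
  assumes "Suc i < n" "Suc j < n" "i \<noteq> j"
  defines "q \<equiv> 1 / (2 * (real n - 1))"
  defines "F \<equiv> \<lambda>x y. pmf (superdiagonal_joint_law n i j l) (x, y)"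
  shows "pmf (superdiagonal_joint_law n i j (Suc l)) (x, y) =
    (1 - 4 * q) * F x y + q * (F x (y - 1) + F x (y + 1)) + q * (F (x - 1) y + F (x + 1) y)"
proof -
  have "pmf (superdiagonal_joint_law n i j (Suc l)) (x, y) =
     (\<Sum>k<n - 1. F (x - of_bool (i = k)) (y - of_bool (j = k)) +
       F (x + of_bool (i = k)) (y + of_bool (j = k))) / (2 * (real n - 1))"
    unfolding superdiagonal_joint_law_def F_def
    using assms by (subst pmf_map_random_walk_Suc)
      (auto intro: superdiagonal_mult simp: superdiagonal_elementary)
  also have "\<dots> = q * ((F (x - 1) y + F (x + 1) y) + (F x (y - 1) + F x (y + 1)) +
      (real (n - 1) - 2) * (2 * F x y))"
    using assms by (subst sum_of_bool_pair[where f = "\<lambda>b c. F (x - of_bool b) (y - of_bool c) +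
       F (x + of_bool b) (y + of_bool c)"]) (auto simp: q_def)
  finally have "pmf (superdiagonal_joint_law n i j (Suc l)) (x, y) =
      q * ((F (x - 1) y + F (x + 1) y) + (F x (y - 1) + F x (y + 1)) + (real (n - 1) - 2) * (2 * F x y))" .
  moreover have "q * (2 * (real n - 1)) * F x y = F x y" "real (n - 1) = real n - 1"
    using assms(1) by (simp_all add: q_def of_nat_diff)
  ultimately show ?thesis by (simp add: algebra_simps)
qed

section \<open>Radially decreasing functions and binomial bounds\<close>

text \<open>The non-strict comparison of absolute values includes symmetry, by taking
  \<open>y = - x\<close> in both directions.\<close>

definition radially_decreasing :: "(int \<Rightarrow> real) \<Rightarrow> bool" where
  "radially_decreasing F \<longleftrightarrow> (\<forall>x y. \<bar>x\<bar> \<le> \<bar>y\<bar> \<longrightarrow> F y \<le> F x)"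

lemma radially_decreasingI:
  assumes sym: "\<And>x. F (- x) = F x" and dec: "\<And>x. 0 \<le> x \<Longrightarrow> F (x + 1) \<le> F x"
  shows "radially_decreasing F"
  unfolding radially_decreasing_def
proof (intro allI impI)
  fix x y :: int assume xy: "\<bar>x\<bar> \<le> \<bar>y\<bar>"
  have abs: "F \<bar>z\<bar> = F z" for z using sym[of z] by (simp add: abs_if)
  have "F (\<bar>x\<bar> + int d) \<le> F \<bar>x\<bar>" for d
  proof (induction d)
    case (Suc d)
    then show ?case using dec[of "\<bar>x\<bar> + int d"] by (simp add: add_ac)
  qed simp
  from this[of "nat (\<bar>y\<bar> - \<bar>x\<bar>)"] show "F y \<le> F x" using xy abs by simp
qed

lemma radially_decreasingD: "radially_decreasing F \<Longrightarrow> \<bar>x\<bar> \<le> \<bar>y\<bar> \<Longrightarrow> F y \<le> F x"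
  by (simp add: radially_decreasing_def)

lemma radially_decreasing_minus: "radially_decreasing F \<Longrightarrow> F (- x) = F x"
  by (intro antisym) (auto intro: radially_decreasingD)

lemma radially_decreasing_delta: "radially_decreasing (\<lambda>x. of_bool (x = 0))"
  by (simp add: radially_decreasing_def)

lemma radially_decreasing_add:
  "radially_decreasing F \<Longrightarrow> radially_decreasing G \<Longrightarrow> radially_decreasing (\<lambda>x. F x + G x)"
  unfolding radially_decreasing_def by (meson add_mono)

lemma radially_decreasing_cmult:
  "radially_decreasing F \<Longrightarrow> 0 \<le> c \<Longrightarrow> radially_decreasing (\<lambda>x. c * F x)"
  unfolding radially_decreasing_def by (meson mult_left_mono)

text \<open>The critical comparison is between \<open>0\<close> and \<open>1\<close>: there the
  neighbour \<open>-1\<close> reflects to \<open>1\<close>, leaving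
  \<open>(r - q) * (F 0 - F 1)\<close>, which is why the holding weight must be at least
  \<open>q\<close>.\<close>

lemma radially_decreasing_lazy_step:
  assumes F: "radially_decreasing F" and q: "0 \<le> q" "q \<le> r"
  shows "radially_decreasing (\<lambda>x. r * F x + q * (F (x - 1) + F (x + 1)))"
proof (rule radially_decreasingI)
  fix x :: int
  have "- x - 1 = - (x + 1)" "- x + 1 = - (x - 1)" by linarith+
  then show "r * F (- x) + q * (F (- x - 1) + F (- x + 1)) = r * F x + q * (F (x - 1) + F (x + 1))"
    by (simp only: radially_decreasing_minus[OF F] add.commute)
next
  fix x :: int assume x: "0 \<le> x"
  have "q * (F (x + 1) - F (x + 2)) \<ge> 0"
    using q radially_decreasingD[OF F, of "x + 1" "x + 2"] x by simp
  moreover have "r * (F x - F (x + 1)) + q * (F (x - 1) - F x) \<ge> 0"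
  proof (cases "x = 0")
    case True
    have "(r - q) * (F 0 - F 1) \<ge> 0"
      using q radially_decreasingD[OF F, of 0 1] by simp
    moreover have "F (- 1) = F 1" using radially_decreasing_minus[OF F, of 1] by simp
    ultimately show ?thesis using True by (simp add: algebra_simps)
  next
    case False
    then have "F x \<le> F (x - 1)" "F (x + 1) \<le> F x"
      using x by (auto intro!: radially_decreasingD[OF F])
    then show ?thesis using q by simp
  qed
  ultimately show "r * F (x + 1) + q * (F (x + 1 - 1) + F (x + 1 + 1)) \<le>
      r * F x + q * (F (x - 1) + F (x + 1))"
    by (simp add: algebra_simps)
qed

text \<open>The value at a nonzero multiple \<open>c\<close> of \<open>d\<close> is at most the average over the block of
  \<open>d\<close> integers ending at \<open>c\<close> on the side of \<open>0\<close>, and these blocks are disjoint.\<close>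

lemma radially_decreasing_sum_multiples:
  fixes F :: "int \<Rightarrow> real" and L d :: int
  assumes F: "radially_decreasing F" and nonneg: "\<And>x. 0 \<le> F x" and d: "0 < d"
    and C: "C \<subseteq> {-L..L} \<inter> {c. c \<noteq> 0 \<and> d dvd c}"
  shows "d * (\<Sum>c\<in>C. F c) \<le> (\<Sum>c\<in>{-L..L} - {0}. F c)"
proof -
  have fin: "finite C" using C by (rule finite_subset) auto
  define g where "g = (\<lambda>(c, i). c - sgn c * i :: int)"
  have inj: "inj_on g (C \<times> {0..<d})"
  proof (rule inj_onI, clarify)
    fix c i c' i' assume H: "c \<in> C" "i \<in> {0..<d}" "c' \<in> C" "i' \<in> {0..<d}" "g (c, i) = g (c', i')"
    have "d dvd c" "d dvd c'" using H C by auto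
    then obtain t t' where t: "c = d * t" "c' = d * t'" by (elim dvdE)
    have nz: "t \<noteq> 0" "t' \<noteq> 0" using H C t by auto
    have s: "sgn c = sgn t" "sgn c' = sgn t'" using t d by (auto simp: sgn_mult)
    have eq: "d * t - sgn t * i = d * t' - sgn t' * i'"
      using H(5) t s by (simp add: g_def)
    have pos: "d * u - i > 0" if "u \<ge> 1" "i < d" for u i
    proof -
      have "d * 1 \<le> d * u" using that d by (intro mult_left_mono) auto
      then show ?thesis using that by simp
    qed
    have neg: "d * u + i < 0" if "u \<le> -1" "i < d" for u i
      using pos[of "- u" i] that by simp
    \<comment> \<open>Blocks of positive multiples stay positive and those of negative multiples
      negative, so \<open>t\<close> and \<open>t'\<close> have the same sign. Then
      \<open>d * (t - t')\<close> is up to sign a difference of two offsets below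
      \<open>d\<close>.\<close>
    have "t = t'"
    proof (cases "t > 0")
      case True
      have "t' > 0"
      proof (rule ccontr)
        assume "\<not> t' > 0"
        then show False
          using eq True nz pos[of t i] neg[of t' i'] H by (auto simp: sgn_if)
      qed
      then have e: "d * (t - t') = i - i'" using eq True by (simp add: algebra_simps)
      show ?thesis
      proof (rule ccontr)
        assume "t \<noteq> t'"
        then have "\<bar>d * (t - t')\<bar> \<ge> d" using d by (simp add: abs_mult)
        then show False using e H by auto
      qed
    next
      case False
      have "t' < 0"
      proof (rule ccontr)
        assume "\<not> t' < 0"
        then show False
          using eq False nz pos[of t' i'] neg[of t i] H by (auto simp: sgn_if)
      qed
      then have e: "d * (t - t') = i' - i" using eq False nz by (simp add: algebra_simps)
      show ?thesis
      proof (rule ccontr)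
        assume "t \<noteq> t'"
        then have "\<bar>d * (t - t')\<bar> \<ge> d" using d by (simp add: abs_mult)
        then show False using e H by auto
      qed
    qed
    then have "sgn t * i = sgn t * i'" using eq by simp
    then show "c = c' \<and> i = i'" using \<open>t = t'\<close> t nz by (simp add: sgn_0_0)
  qed
  have bound: "\<bar>g (c, i)\<bar> \<le> \<bar>c\<bar> \<and> g (c, i) \<noteq> 0" if "c \<in> C" "i \<in> {0..<d}" for c i
  proof -
    have c: "c \<noteq> 0" "d \<le> \<bar>c\<bar>" using C that d by (auto dest!: dvd_imp_le_int)
    then show ?thesis using that by (auto simp: g_def sgn_if)
  qed
  have "d * (\<Sum>c\<in>C. F c) = (\<Sum>c\<in>C. \<Sum>i\<in>{0..<d}. F c)"
    using d by (simp add: sum_distrib_left)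
  also have "\<dots> \<le> (\<Sum>c\<in>C. \<Sum>i\<in>{0..<d}. F (g (c, i)))"
    using bound by (intro sum_mono radially_decreasingD[OF F]) auto
  also have "\<dots> = (\<Sum>x\<in>g ` (C \<times> {0..<d}). F x)"
    using inj by (simp add: sum.cartesian_product sum.reindex case_prod_unfold)
  also have "\<dots> \<le> (\<Sum>c\<in>{-L..L} - {0}. F c)"
  proof (rule sum_mono2)
    show "g ` (C \<times> {0..<d}) \<subseteq> {- L..L} - {0}"
    proof clarify
      fix c i assume ci: "c \<in> C" "i \<in> {0..<d}"
      have "\<bar>c\<bar> \<le> L" using C ci by (auto simp: abs_le_iff subset_iff)
      with bound[OF ci] show "g (c, i) \<in> {-L..L} - {0}" by auto
    qed
  qed (use nonneg in auto)
  finally show ?thesis .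
qed

section \<open>Decay estimates for binomial weights\<close>

lemma central_binomial_le: "real (2 * k choose k) / 4 ^ k \<le> 1 / sqrt (2 * real k + 1)"
proof (induction k)
  case (Suc k)
  \<comment> \<open>The normalized coefficients have ratio \<open>(2 * k + 1) / (2 * k + 2)\<close>;
    the induction closes because
    \<open>(2 * k + 1) * (2 * k + 3) \<le> (2 * k + 2)\<^sup>2\<close>.\<close>
  have rec: "real (2 * Suc k choose Suc k) * (real k + 1) = real (2 * k choose k) * (2 * (2 * real k + 1))"
  proof -
    have a: "Suc k * (Suc (Suc (2 * k)) choose Suc k) = Suc (Suc (2 * k)) * (Suc (2 * k) choose k)"
      by (rule Suc_times_binomial)
    have b: "Suc k * (Suc (2 * k) choose k) = Suc (2 * k) * (2 * k choose k)"
      using binomial_absorb_comp[of "Suc (2 * k)" k] by simp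
    have "Suc k * (Suc k * (Suc (Suc (2 * k)) choose Suc k)) = Suc k * ((2 * k choose k) * (2 * (2 * k + 1)))"
    proof -
      have "Suc k * (Suc (Suc (2 * k)) * (Suc (2 * k) choose k)) = 2 * Suc k * (Suc k * (Suc (2 * k) choose k))"
        by (simp add: algebra_simps)
      then show ?thesis unfolding a b by (simp add: algebra_simps)
    qed
    then have "(2 * Suc k choose Suc k) * (k + 1) = (2 * k choose k) * (2 * (2 * k + 1))"
      by (metis Suc_eq_plus1 add_2_eq_Suc mult.commute mult_Suc_right nat_mult_eq_cancel1 zero_less_Suc)
    then have "real ((2 * Suc k choose Suc k) * (k + 1)) = real ((2 * k choose k) * (2 * (2 * k + 1)))"
      by (simp only:)
    then show ?thesis unfolding of_nat_mult of_nat_add by simp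
  qed
  have "real (2 * Suc k choose Suc k) = real (2 * k choose k) * (2 * (2 * real k + 1)) / (real k + 1)"
    using rec by (simp add: field_simps)
  moreover have "b * (2 * c) / d / (4 * p) = b / p * (c / (2 * d))" for b c d p :: real
    by simp
  ultimately have "real (2 * Suc k choose Suc k) / 4 ^ Suc k =
      real (2 * k choose k) / 4 ^ k * ((2 * real k + 1) / (2 * (real k + 1)))"
    unfolding power_Suc by (simp only:)
  also have "\<dots> = real (2 * k choose k) / 4 ^ k * ((2 * real k + 1) / (2 * real k + 2))"
    by (simp add: algebra_simps)
  also have "\<dots> \<le> 1 / sqrt (2 * real k + 1) * ((2 * real k + 1) / (2 * real k + 2))"
    by (intro mult_right_mono Suc.IH) simp
  also have "\<dots> = sqrt (2 * real k + 1) / (2 * real k + 2)"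
  proof -
    have "0 < sqrt (2 * real k + 1)" "sqrt (2 * real k + 1) * sqrt (2 * real k + 1) = 2 * real k + 1"
      by simp_all
    moreover have "1 / s * (a / b) = s / b" if "0 < s" "s * s = a" for s a b :: real
      using that by (simp flip: that(2))
    ultimately show ?thesis by blast
  qed
  also have "\<dots> \<le> 1 / sqrt (2 * real (Suc k) + 1)"
  proof -
    have "sqrt (2 * real k + 1) * sqrt (2 * real k + 3) \<le> sqrt ((2 * real k + 2)\<^sup>2)"
      unfolding real_sqrt_mult[symmetric] by (rule real_sqrt_le_mono) (simp add: power2_eq_square algebra_simps)
    then have "sqrt (2 * real k + 1) * sqrt (2 * real k + 3) \<le> 2 * real k + 2" by simp
    moreover have "0 < sqrt (2 * real k + 3)" by simp
    moreover have "2 * real (Suc k) + 1 = 2 * real k + 3" by simp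
    ultimately show ?thesis by (simp only:) (simp add: field_simps)
  qed
  finally show ?case .
qed simp

text \<open>Jensen's inequality for the square root, applied to
  \<open>E (1 / (k + 1)) \<le> 1 / (r (l + 1))\<close> for a binomial variable \<open>k\<close>.\<close>

lemma binomial_inverse_sqrt_le:
  fixes r :: real
  assumes r: "0 < r" "r \<le> 1"
  shows "(\<Sum>k\<le>l. real (l choose k) * r ^ k * (1 - r) ^ (l - k) / sqrt (real k + 1))
    \<le> 1 / sqrt (r * (real l + 1))"
proof -
  define w where "w k = real (l choose k) * r ^ k * (1 - r) ^ (l - k)" for k
  have w0: "0 \<le> w k" for k using r by (simp add: w_def)
  have w1: "(\<Sum>k\<le>l. w k) = 1"
    using binomial_ring[of r "1 - r" l] by (simp add: w_def)
  have shift: "w k / (real k + 1) * (r * (real l + 1)) =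
      real (Suc l choose Suc k) * r ^ Suc k * (1 - r) ^ (Suc l - Suc k)" for k
  proof -
    have "real (Suc k * (Suc l choose Suc k)) = real (Suc l * (l choose k))"
      by (simp only: Suc_times_binomial)
    then have "real (Suc l choose Suc k) = real (l choose k) * (real l + 1) / (real k + 1)"
      by (simp add: field_simps del: binomial_Suc_Suc)
    then show ?thesis unfolding w_def by (simp only:) (simp add: field_simps)
  qed
  \<comment> \<open>After this scaling the terms are the weights of a binomial law with
    \<open>l + 1\<close> trials, with the outcome \<open>0\<close> missing, so they sum to at most
    one.\<close>
  have "(\<Sum>k\<le>l. w k / (real k + 1)) * (r * (real l + 1)) =
      (\<Sum>k\<le>l. real (Suc l choose Suc k) * r ^ Suc k * (1 - r) ^ (Suc l - Suc k))"
    unfolding sum_distrib_right shift ..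
  also have "\<dots> \<le> (\<Sum>k\<le>Suc l. real (Suc l choose k) * r ^ k * (1 - r) ^ (Suc l - k))"
    using r by (subst sum.atMost_Suc_shift) simp
  also have "\<dots> = 1" using binomial_ring[of r "1 - r" "Suc l"] by simp
  finally have m: "(\<Sum>k\<le>l. w k / (real k + 1)) \<le> 1 / (r * (real l + 1))"
    using r by (subst pos_le_divide_eq) auto
  \<comment> \<open>Jensen takes the form of Cauchy-Schwarz: one factor \<open>sqrt (w k)\<close> is
    split off, and its squares have total mass one.\<close>
  have "(\<Sum>k\<le>l. w k / sqrt (real k + 1))\<^sup>2 = (\<Sum>k\<le>l. sqrt (w k) * (sqrt (w k) / sqrt (real k + 1)))\<^sup>2"
    using w0 by (simp add: real_sqrt_mult_self)
  also have "\<dots> \<le> (\<Sum>k\<le>l. (sqrt (w k))\<^sup>2) * (\<Sum>k\<le>l. (sqrt (w k) / sqrt (real k + 1))\<^sup>2)"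
    by (rule Cauchy_Schwarz_ineq_sum)
  also have "\<dots> = (\<Sum>k\<le>l. w k / (real k + 1))"
    using w0 w1 by (simp add: power_divide)
  also have "\<dots> \<le> 1 / (r * (real l + 1))" by (rule m)
  finally have "(\<Sum>k\<le>l. w k / sqrt (real k + 1)) \<le> sqrt (1 / (r * (real l + 1)))"
    by (rule real_le_rsqrt)
  then show ?thesis by (simp add: w_def real_sqrt_divide)
qed

section \<open>Monotonicity and return probability of the superdiagonal laws\<close>

lemma radially_decreasing_superdiagonal_law:
  assumes "Suc i < n" "3 \<le> n"
  shows "radially_decreasing (pmf (superdiagonal_law n i l))"
proof (induction l)
  case 0
  then show ?case
    using radially_decreasing_delta pmf_superdiagonal_law_0[OF assms(1)] by presburger
next
  case (Suc l)
  define q where "q = 1 / (2 * (real n - 1))"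
  \<comment> \<open>For \<open>n = 2\<close> the walk is simple and confined to one parity class;
    from \<open>n = 3\<close> on, \<open>q \<le> 1 / 4\<close> makes it lazy enough.\<close>
  have q: "0 \<le> q" "q \<le> 1 - 2 * q" using assms by (simp_all add: q_def field_simps)
  show ?case
    using radially_decreasing_lazy_step[OF Suc q] pmf_superdiagonal_law_Suc[OF assms(1), of l]
    by (simp add: q_def cong: arg_cong[where f = radially_decreasing])
qed

lemma radially_decreasing_superdiagonal_joint_law:
  assumes ij: "Suc i < n" "Suc j < n" "i \<noteq> j" and n: "4 \<le> n"
  shows "radially_decreasing (\<lambda>y. pmf (superdiagonal_joint_law n i j l) (x, y))"
proof (induction l arbitrary: x)
  case 0
  show ?case
    using radially_decreasing_cmult[OF radially_decreasing_delta, of "of_bool (x = 0)"]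
    by (simp add: pmf_superdiagonal_joint_law_0[OF ij(1,2)] of_bool_conj)
next
  case (Suc l)
  define q where "q = 1 / (2 * (real n - 1))"
  \<comment> \<open>Two coordinates use up more of the holding probability:
    \<open>q \<le> 1 / 5\<close> is required, and \<open>n \<ge> 4\<close> gives
    \<open>q \<le> 1 / 6\<close>.\<close>
  have q: "0 \<le> q" "q \<le> 1 - 4 * q" using n by (simp_all add: q_def field_simps)
  show ?case
    unfolding pmf_superdiagonal_joint_law_Suc[OF ij] q_def[symmetric]
    by (intro radially_decreasing_add[of "\<lambda>y. _ y + _ y"] radially_decreasing_lazy_step
        radially_decreasing_cmult radially_decreasing_add Suc q)
qed

text \<open>Extension by zero to negative integers lets Pascal's rule hold at every integer,
  including the boundary.\<close>

definition int_binomial :: "nat \<Rightarrow> int \<Rightarrow> real" where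
  "int_binomial m x = (if x < 0 then 0 else real (m choose nat x))"

lemma int_binomial_Suc: "int_binomial (Suc m) x = int_binomial m x + int_binomial m (x - 1)"
proof (cases "x \<le> 0")
  case False
  then obtain k where "x = int (Suc k)" by (metis gr0_implies_Suc not_le zero_less_imp_eq_int)
  then show ?thesis by (simp add: int_binomial_def nat_add_distrib)
qed (auto simp: int_binomial_def)

text \<open>With \<open>r = 4 q\<close> the step generating function \<open>1 - 2 q + q z + q z\<^sup>-\<^sup>1\<close> equals
  \<open>1 - r + r (1 + z) (1 + z\<^sup>-\<^sup>1) / 4\<close>, hence the mixture of even binomial laws.\<close>

lemma pmf_superdiagonal_law_eq:
  fixes n l i
  assumes i: "Suc i < n"
  defines "r \<equiv> 2 / (real n - 1)"
  shows "pmf (superdiagonal_law n i l) x =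
    (\<Sum>k\<le>l. real (l choose k) * r ^ k * (1 - r) ^ (l - k) * (int_binomial (2 * k) (int k + x) / 4 ^ k))"
proof (induction l arbitrary: x)
  case 0
  show ?case
    using pmf_superdiagonal_law_0[OF i, of x] by (auto simp: int_binomial_def binomial_eq_0)
next
  case (Suc l)
  define s where "s k x = int_binomial (2 * k) (int k + x) / 4 ^ k" for k x
  define w where "w l k = real (l choose k) * r ^ k * (1 - r) ^ (l - k)" for l k
  have s: "s (Suc k) x = (s k (x - 1) + 2 * s k x + s k (x + 1)) / 4" for k x
    by (simp add: s_def int_binomial_Suc add_divide_distrib algebra_simps)
  have w: "w (Suc l) (Suc k) = (1 - r) * w l (Suc k) + r * w l k" for k
  proof (cases "k < l")
    case True
    then have "l - k = Suc (l - Suc k)" by simp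
    then show ?thesis by (simp add: w_def algebra_simps)
  qed (auto simp: w_def binomial_eq_0 algebra_simps)
  have IH: "pmf (superdiagonal_law n i l) y = (\<Sum>k\<le>l. w l k * s k y)" for y
    using Suc[of y] by (simp add: w_def s_def)
  have q: "1 - 2 * (1 / (2 * (real n - 1))) = (1 - r) + r / 2" "1 / (2 * (real n - 1)) = r / 4"
  proof -
    have "1 - 2 * (1 / (2 * d)) = (1 - 2 / d) + 2 / d / 2" "1 / (2 * d) = 2 / d / 4" for d :: real
      by (cases "d = 0"; simp add: field_simps)+
    then show "1 - 2 * (1 / (2 * (real n - 1))) = (1 - r) + r / 2" "1 / (2 * (real n - 1)) = r / 4"
      unfolding r_def by blast+
  qed
  have "pmf (superdiagonal_law n i (Suc l)) x =
      (1 - r) * (\<Sum>k\<le>l. w l k * s k x) + r * (\<Sum>k\<le>l. w l k * s (Suc k) x)"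
  proof -
    have "pmf (superdiagonal_law n i (Suc l)) x =
        (\<Sum>k\<le>l. (1 - r) * (w l k * s k x) + r * (w l k * s (Suc k) x))"
      unfolding pmf_superdiagonal_law_Suc[OF i] q IH sum_distrib_left sum.distrib[symmetric]
      by (rule sum.cong[OF refl]) (simp add: s field_simps)
    then show ?thesis by (simp add: sum.distrib sum_distrib_left)
  qed
  \<comment> \<open>The added term is zero, since \<open>l choose Suc l = 0\<close>; both sums can
    then be aligned at \<open>Suc k\<close> and merged by Pascal's rule for the weights.\<close>
  also have "(\<Sum>k\<le>l. w l k * s k x) = (\<Sum>k\<le>Suc l. w l k * s k x)"
    by (simp add: w_def)
  also have "\<dots> = w l 0 * s 0 x + (\<Sum>k\<le>l. w l (Suc k) * s (Suc k) x)"
    by (rule sum.atMost_Suc_shift)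
  also have "(1 - r) * \<dots> + r * (\<Sum>k\<le>l. w l k * s (Suc k) x) =
      w (Suc l) 0 * s 0 x + (\<Sum>k\<le>l. w (Suc l) (Suc k) * s (Suc k) x)"
  proof -
    have "w (Suc l) 0 = (1 - r) * w l 0" by (simp add: w_def)
    then show ?thesis
      unfolding w by (simp add: distrib_left distrib_right sum.distrib sum_distrib_left mult.assoc)
  qed
  also have "\<dots> = (\<Sum>k\<le>Suc l. w (Suc l) k * s k x)"
    by (rule sum.atMost_Suc_shift[symmetric])
  finally show ?case by (simp add: w_def s_def)
qed

text \<open>At \<open>0\<close> the mixture consists of normalized central binomial coefficients, of
  order \<open>1 / sqrt k\<close>, averaged over a binomial number of effective steps. The
  assumption \<open>n \<ge> 3\<close> makes the mixing parameter \<open>r\<close> a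
  probability.\<close>

lemma pmf_superdiagonal_law_at_0_le:
  assumes i: "Suc i < n" and n: "3 \<le> n" and l: "0 < l"
  shows "pmf (superdiagonal_law n i l) 0 \<le> sqrt (real n / real l)"
proof -
  define r where "r = 2 / (real n - 1)"
  have r: "0 < r" "r \<le> 1" using n by (simp_all add: r_def)
  have "pmf (superdiagonal_law n i l) 0 =
      (\<Sum>k\<le>l. real (l choose k) * r ^ k * (1 - r) ^ (l - k) * (real (2 * k choose k) / 4 ^ k))"
    unfolding pmf_superdiagonal_law_eq[OF i] r_def by (simp add: int_binomial_def)
  also have "\<dots> \<le> (\<Sum>k\<le>l. real (l choose k) * r ^ k * (1 - r) ^ (l - k) * (1 / sqrt (real k + 1)))"
  proof (intro sum_mono mult_left_mono)
    fix k
    have "1 / sqrt (2 * real k + 1) \<le> 1 / sqrt (real k + 1)"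
      by (intro divide_left_mono real_sqrt_le_mono) auto
    with central_binomial_le[of k] show "real (2 * k choose k) / 4 ^ k \<le> 1 / sqrt (real k + 1)"
      by linarith
  qed (use r in auto)
  also have "\<dots> \<le> 1 / sqrt (r * (real l + 1))"
    using binomial_inverse_sqrt_le[OF r, of l] by simp
  also have "\<dots> = sqrt (1 / (r * (real l + 1)))"
    by (simp add: real_sqrt_divide)
  also have "\<dots> \<le> sqrt (real n / real l)"
  proof (rule real_sqrt_le_mono)
    have "1 / (r * (real l + 1)) = (real n - 1) / (2 * (real l + 1))"
      using n by (simp add: r_def)
    also have "\<dots> \<le> real n / real l"
      using n l by (intro frac_le) auto
    finally show "1 / (r * (real l + 1)) \<le> real n / real l" .
  qed
  finally show ?thesis .
qed

section \<open>Failure probability\<close>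

lemma measure_pmf_sum_superset:
  assumes "finite B" "set_pmf p \<subseteq> B"
  shows "measure_pmf.prob p A = (\<Sum>x\<in>A \<inter> B. pmf p x)"
proof -
  have "measure_pmf.prob p A = measure_pmf.prob p (A \<inter> B)"
    using assms(2) by (intro measure_pmf.finite_measure_eq_AE) (auto simp: AE_measure_pmf_iff)
  then show ?thesis using assms(1) by (simp add: measure_measure_pmf_finite)
qed

lemma finite_int_subset_interval:
  fixes S :: "int set"
  assumes "finite S"
  obtains L where "S \<subseteq> {-L..L}"
proof
  show "S \<subseteq> {-(\<Sum>x\<in>S. \<bar>x\<bar>)..(\<Sum>x\<in>S. \<bar>x\<bar>)}"
    using assms member_le_sum[of _ S "\<lambda>x. \<bar>x\<bar>"] by (fastforce simp: abs_le_iff)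
qed

lemma prob_multiple_le:
  fixes p :: "int pmf"
  assumes p: "radially_decreasing (pmf p)" "finite (set_pmf p)" and d: "0 < d"
  shows "measure_pmf.prob p {c. c \<noteq> 0 \<and> d dvd c} \<le> 1 / real_of_int d"
proof -
  obtain L where L: "set_pmf p \<subseteq> {-L..L}" using finite_int_subset_interval[OF p(2)] .
  have "d * measure_pmf.prob p {c. c \<noteq> 0 \<and> d dvd c} = d * (\<Sum>c\<in>{c. c \<noteq> 0 \<and> d dvd c} \<inter> {-L..L}. pmf p c)"
    using L by (subst measure_pmf_sum_superset) auto
  also have "\<dots> \<le> (\<Sum>c\<in>{-L..L} - {0}. pmf p c)"
    using p d by (intro radially_decreasing_sum_multiples) auto
  also have "\<dots> = measure_pmf.prob p ({-L..L} - {0})" by (simp add: measure_measure_pmf_finite)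
  also have "\<dots> \<le> 1" by simp
  finally show ?thesis using d by (simp add: field_simps)
qed

text \<open>A common divisor \<open>d\<close> divides both independent variables, with probability
  at most \<open>1 / d\<^sup>2\<close>. Bounding this by \<open>1 / (d - 1) - 1 / d\<close> makes
  the union bound over all \<open>d \<ge> m\<close> telescope.\<close>

lemma prob_large_gcd_le:
  fixes p q :: "int pmf" and m :: nat
  assumes p: "radially_decreasing (pmf p)" "finite (set_pmf p)"
    and q: "radially_decreasing (pmf q)" "finite (set_pmf q)" and m: "2 \<le> m"
  shows "measure_pmf.prob (pair_pmf p q) {(a, b). a \<noteq> 0 \<and> b \<noteq> 0 \<and> int m \<le> gcd a b} \<le> 1 / (real m - 1)"
proof -
  define A where "A i = {c. c \<noteq> 0 \<and> int (m + i) dvd c}" for i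
  have tele: "(\<lambda>i. 1 / (real (m + i) - 1) - 1 / (real (m + Suc i) - 1)) sums (1 / (real m - 1) - 0)"
  proof -
    have "(\<lambda>i. 1 / (real (m + i) - 1)) \<longlonglongrightarrow> 0" by real_asymp
    from telescope_sums'[OF this] show ?thesis by simp
  qed
  have le: "measure_pmf.prob (pair_pmf p q) (A i \<times> A i) \<le>
      1 / (real (m + i) - 1) - 1 / (real (m + Suc i) - 1)" for i
  proof -
    have "measure_pmf.prob (pair_pmf p q) (A i \<times> A i) =
        measure_pmf.prob p (A i) * measure_pmf.prob q (A i)"
      by (rule measure_pmf_prob_product) auto
    also have "\<dots> \<le> (1 / real_of_int (int (m + i))) * (1 / real_of_int (int (m + i)))"
      unfolding A_def using m p q by (intro mult_mono prob_multiple_le) auto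
    also have "\<dots> \<le> 1 / ((real (m + i) - 1) * real (m + i))"
      using m by (simp add: divide_simps mult_mono)
    also have "\<dots> = 1 / (real (m + i) - 1) - 1 / (real (m + Suc i) - 1)"
      using m by (simp add: field_simps)
    finally show ?thesis .
  qed
  have summ: "summable (\<lambda>i. measure_pmf.prob (pair_pmf p q) (A i \<times> A i))"
    by (rule summable_comparison_test'[OF sums_summable[OF tele]]) (use le in auto)
  have "measure_pmf.prob (pair_pmf p q) {(a, b). a \<noteq> 0 \<and> b \<noteq> 0 \<and> int m \<le> gcd a b}
      \<le> measure_pmf.prob (pair_pmf p q) (\<Union>i. A i \<times> A i)"
  proof (intro measure_pmf.finite_measure_mono subsetI, clarify)
    fix a b :: int assume ab: "a \<noteq> 0" "b \<noteq> 0" "int m \<le> gcd a b"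
    then have "int (m + nat (gcd a b - int m)) = gcd a b" by simp
    then show "(a, b) \<in> (\<Union>i. A i \<times> A i)"
      using ab unfolding A_def by (intro UN_I[of "nat (gcd a b - int m)"]) auto
  qed simp
  also have "\<dots> \<le> (\<Sum>i. measure_pmf.prob (pair_pmf p q) (A i \<times> A i))"
    using summ by (intro measure_pmf.finite_measure_subadditive_countably) auto
  also have "\<dots> \<le> (\<Sum>i. 1 / (real (m + i) - 1) - 1 / (real (m + Suc i) - 1))"
    using le summ sums_summable[OF tele] by (intro suminf_le) auto
  also have "\<dots> = 1 / (real m - 1)" using sums_unique[OF tele] by simp
  finally show ?thesis .
qed

text \<open>At most \<open>2 * N + 1\<close> integers qualify, and none is more likely than
  \<open>0\<close>.\<close>

lemma prob_small_le:
  fixes p :: "int pmf" and N :: real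
  assumes p: "radially_decreasing (pmf p)" and N: "0 < N"
  shows "measure_pmf.prob p {a. \<bar>real_of_int a\<bar> < N} \<le> (2 * N + 1) * pmf p 0"
proof -
  have sub: "{a. \<bar>real_of_int a\<bar> < N} \<subseteq> {-(\<lceil>N\<rceil> - 1)..\<lceil>N\<rceil> - 1}"
  proof
    fix a :: int assume "a \<in> {a. \<bar>real_of_int a\<bar> < N}"
    then have "real_of_int a < N" "real_of_int (- a) < N" by auto
    then have "a < \<lceil>N\<rceil>" "- a < \<lceil>N\<rceil>" by (simp_all only: less_ceiling_iff)
    then show "a \<in> {-(\<lceil>N\<rceil> - 1)..\<lceil>N\<rceil> - 1}" by simp
  qed
  have "measure_pmf.prob p {a. \<bar>real_of_int a\<bar> < N} \<le> measure_pmf.prob p {-(\<lceil>N\<rceil> - 1)..\<lceil>N\<rceil> - 1}"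
    using sub by (intro measure_pmf.finite_measure_mono) auto
  also have "\<dots> = (\<Sum>a\<in>{-(\<lceil>N\<rceil> - 1)..\<lceil>N\<rceil> - 1}. pmf p a)" by (simp add: measure_measure_pmf_finite)
  also have "\<dots> \<le> (\<Sum>a\<in>{-(\<lceil>N\<rceil> - 1)..\<lceil>N\<rceil> - 1}. pmf p 0)"
    by (intro sum_mono radially_decreasingD[OF p]) auto
  also have "\<dots> = (2 * real_of_int \<lceil>N\<rceil> - 1) * pmf p 0"
  proof -
    have "1 \<le> \<lceil>N\<rceil>" using N by (simp add: le_ceiling_iff)
    then show ?thesis by simp
  qed
  also have "\<dots> \<le> (2 * N + 1) * pmf p 0"
    by (intro mult_right_mono) (use ceiling_correct[of N] in linarith, simp)
  finally show ?thesis .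
qed

text \<open>For given first entries \<open>a\<close>, \<open>b\<close>, parallelism forces \<open>c\<close> to be a multiple of
  \<open>a / gcd a b\<close> and determines \<open>d\<close>, whose conditional weight is at most that of \<open>d = 0\<close>.\<close>

lemma prob_parallel_le:
  fixes p :: "(int \<times> int) pmf" and \<kappa> :: real
  assumes rad: "\<And>a. radially_decreasing (\<lambda>c. pmf p (a, c))" and fin: "finite (set_pmf p)"
    and \<kappa>: "0 < \<kappa>"
  shows "measure_pmf.prob (pair_pmf p p)
      {((a, c), (b, d)). a * d = b * c \<and> c \<noteq> 0 \<and> a \<noteq> 0 \<and> \<kappa> * real_of_int (gcd a b) \<le> \<bar>real_of_int a\<bar>}
    \<le> measure_pmf.prob p {(b, d). d = 0} / \<kappa>"
    (is "measure_pmf.prob _ ?E \<le> _")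
proof -
  obtain L1 where L1: "fst ` set_pmf p \<subseteq> {-L1..L1}"
    using finite_int_subset_interval[of "fst ` set_pmf p"] fin by auto
  obtain L2 where L2: "snd ` set_pmf p \<subseteq> {-L2..L2}"
    using finite_int_subset_interval[of "snd ` set_pmf p"] fin by auto
  define I where "I = {- L1..L1}"
  define J where "J = {- L2..L2}"
  have finIJ: "finite I" "finite J" by (simp_all add: I_def J_def)
  have supp: "set_pmf p \<subseteq> I \<times> J" using L1 L2 by (force simp: I_def J_def)
  define good where "good a b \<longleftrightarrow> a \<noteq> 0 \<and> \<kappa> * real_of_int (gcd a b) \<le> \<bar>real_of_int a\<bar>" for a b :: int
  define a' where "a' a b = \<bar>a\<bar> div gcd a b" for a b :: int
  \<comment> \<open>\<open>T\<close> contains the triples left after forgetting \<open>d\<close>;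
    nothing is lost, because \<open>a \<noteq> 0\<close> and \<open>a * d = b * c\<close> determine
    \<open>d\<close>.\<close>
  define T where "T = (SIGMA ab:{ab \<in> I \<times> I. good (fst ab) (snd ab)}. {c \<in> J. c \<noteq> 0 \<and> a' (fst ab) (snd ab) dvd c})"
  define \<pi>
    :: "(int \<times> int) \<times> (int \<times> int) \<Rightarrow> (int \<times> int) \<times> int"
    where "\<pi> = (\<lambda>((a, c), (b, d)). ((a, b), c))"
  let ?B = "(I \<times> J) \<times> (I \<times> J)"
  have "measure_pmf.prob (pair_pmf p p) ?E = (\<Sum>z\<in>?E \<inter> ?B. pmf (pair_pmf p p) z)"
    using finIJ supp by (intro measure_pmf_sum_superset) auto
  also have "\<dots> \<le> (\<Sum>z\<in>?E \<inter> ?B. (\<lambda>((a, b), c). pmf p (a, c) * pmf p (b, 0)) (\<pi> z))"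
  proof (rule sum_mono, clarify)
    fix a c b d
    have "pmf p (b, d) \<le> pmf p (b, 0)" using radially_decreasingD[OF rad, of 0 d b] by simp
    then show "pmf (pair_pmf p p) ((a, c), (b, d)) \<le>
        (\<lambda>((a, b), c). pmf p (a, c) * pmf p (b, 0)) (\<pi> ((a, c), (b, d)))"
      by (simp add: \<pi>_def pmf_pair mult_left_mono)
  qed
  also have "\<dots> = (\<Sum>y\<in>\<pi> ` (?E \<inter> ?B). (\<lambda>((a, b), c). pmf p (a, c) * pmf p (b, 0)) y)"
  proof (subst sum.reindex)
    show "inj_on \<pi> (?E \<inter> ?B)"
    proof (rule inj_onI)
      fix z z' assume z: "z \<in> ?E \<inter> ?B" "z' \<in> ?E \<inter> ?B" "\<pi> z = \<pi> z'"
      obtain a c b d where abcd: "z = ((a, c), (b, d))" by (metis surj_pair)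
      obtain d' where z': "z' = ((a, c), (b, d'))" using z(3) by (cases z') (auto simp: \<pi>_def abcd)
      have "a * d = a * d'" "a \<noteq> 0" using z by (auto simp: abcd z')
      then show "z = z'" by (simp add: abcd z')
    qed
  qed simp
  also have "\<dots> \<le> (\<Sum>y\<in>T. (\<lambda>((a, b), c). pmf p (a, c) * pmf p (b, 0)) y)"
  proof (rule sum_mono2)
    show "finite T" unfolding T_def using finIJ by (auto intro!: finite_SigmaI)
    show "\<pi> ` (?E \<inter> ?B) \<subseteq> T"
    proof (rule image_subsetI)
      fix z assume z: "z \<in> ?E \<inter> ?B"
      obtain a c b d where abcd: "z = ((a, c), (b, d))" by (metis surj_pair)
      have H: "a * d = b * c" "c \<noteq> 0" "a \<noteq> 0" "\<kappa> * real_of_int (gcd a b) \<le> \<bar>real_of_int a\<bar>"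
        "a \<in> I" "c \<in> J" "b \<in> I" "d \<in> J"
        using z by (auto simp: abcd)
      have "a' a b dvd c"
      proof -
        have g: "gcd a b \<noteq> 0" using H by simp
        have "a dvd b * c" using H(1) by (metis dvd_triv_left)
        then have "gcd a b * (a div gcd a b) dvd gcd a b * ((b div gcd a b) * c)"
          by (simp add: mult.assoc[symmetric])
        then have "a div gcd a b dvd (b div gcd a b) * c"
          unfolding dvd_mult_cancel_left using g by blast
        moreover have "coprime (a div gcd a b) (b div gcd a b)"
          using H by (intro div_gcd_coprime) auto
        ultimately have "a div gcd a b dvd c" by (simp add: coprime_dvd_mult_right_iff)
        moreover have "a' a b = \<bar>a div gcd a b\<bar>"
          unfolding a'_def by (simp add: abs_div)
        ultimately show ?thesis by simp
      qed
      then show "\<pi> z \<in> T" using H by (simp add: abcd \<pi>_def T_def good_def)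
    qed
  qed (auto simp: case_prod_unfold)
  also have "\<dots> = (\<Sum>(a, b)\<in>{ab \<in> I \<times> I. good (fst ab) (snd ab)}. \<Sum>c\<in>{c \<in> J. c \<noteq> 0 \<and> a' a b dvd c}. pmf p (a, c) * pmf p (b, 0))"
    unfolding T_def using finIJ by (subst sum.Sigma[symmetric]) (auto simp: case_prod_unfold)
  also have "\<dots> \<le> (\<Sum>(a, b)\<in>{ab \<in> I \<times> I. good (fst ab) (snd ab)}. (\<Sum>c\<in>J. pmf p (a, c)) * pmf p (b, 0) / \<kappa>)"
  proof (rule sum_mono)
    fix z assume z: "z \<in> {ab \<in> I \<times> I. good (fst ab) (snd ab)}"
    obtain a b where ab: "z = (a, b)" by (metis surj_pair)
    have g: "a \<noteq> 0" "\<kappa> * real_of_int (gcd a b) \<le> \<bar>real_of_int a\<bar>"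
      using z by (auto simp: ab good_def)
    have "gcd a b * a' a b = \<bar>a\<bar>" by (simp add: a'_def)
    then have "\<kappa> * real_of_int (gcd a b) \<le> real_of_int (gcd a b) * real_of_int (a' a b)"
      using g(2) by (metis of_int_abs of_int_mult)
    moreover have "0 < real_of_int (gcd a b)" using g by simp
    \<comment> \<open>The spacing of the admissible \<open>c\<close> is at least
      \<open>\<kappa>\<close>, so the block estimate for multiples yields the factor
      \<open>1 / \<kappa>\<close>.\<close>
    ultimately have ka: "\<kappa> \<le> real_of_int (a' a b)" by (simp add: mult.commute)
    then have a'0: "0 < a' a b" using \<kappa> by linarith
    have "\<kappa> * (\<Sum>c\<in>{c \<in> J. c \<noteq> 0 \<and> a' a b dvd c}. pmf p (a, c)) \<le>
        real_of_int (a' a b) * (\<Sum>c\<in>{c \<in> J. c \<noteq> 0 \<and> a' a b dvd c}. pmf p (a, c))"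
      using ka by (intro mult_right_mono sum_nonneg) auto
    also have "\<dots> \<le> (\<Sum>c\<in>J - {0}. pmf p (a, c))"
      unfolding J_def using rad a'0 by (intro radially_decreasing_sum_multiples) auto
    also have "\<dots> \<le> (\<Sum>c\<in>J. pmf p (a, c))" using finIJ by (intro sum_mono2) auto
    finally have "(\<Sum>c\<in>{c \<in> J. c \<noteq> 0 \<and> a' a b dvd c}. pmf p (a, c)) \<le> (\<Sum>c\<in>J. pmf p (a, c)) / \<kappa>"
      using \<kappa> by (simp add: field_simps)
    from mult_right_mono[OF this, of "pmf p (b, 0)"]
    show "(case z of (a, b) \<Rightarrow> \<Sum>c\<in>{c \<in> J. c \<noteq> 0 \<and> a' a b dvd c}. pmf p (a, c) * pmf p (b, 0)) \<le>
        (case z of (a, b) \<Rightarrow> (\<Sum>c\<in>J. pmf p (a, c)) * pmf p (b, 0) / \<kappa>)"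
      by (simp add: ab sum_distrib_right)
  qed
  also have "\<dots> \<le> (\<Sum>(a, b)\<in>I \<times> I. (\<Sum>c\<in>J. pmf p (a, c)) * pmf p (b, 0) / \<kappa>)"
    using finIJ \<kappa> by (intro sum_mono2) (auto intro!: divide_nonneg_pos mult_nonneg_nonneg sum_nonneg)
  also have "\<dots> = (\<Sum>a\<in>I. \<Sum>c\<in>J. pmf p (a, c)) * (\<Sum>b\<in>I. pmf p (b, 0)) / \<kappa>"
    by (simp only: sum_product sum.cartesian_product[symmetric] sum_divide_distrib)
  also have "(\<Sum>a\<in>I. \<Sum>c\<in>J. pmf p (a, c)) = 1"
    using sum_pmf_eq_1[of "I \<times> J" p] finIJ supp by (simp add: sum.cartesian_product)
  also have "(\<Sum>b\<in>I. pmf p (b, 0)) \<le> measure_pmf.prob p {(b, d). d = 0}"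
  proof -
    have "(\<Sum>b\<in>I. pmf p (b, 0)) = (\<Sum>z\<in>(\<lambda>b. (b, 0)) ` I. pmf p z)"
      by (simp add: sum.reindex inj_on_def)
    also have "\<dots> = measure_pmf.prob p ((\<lambda>b. (b, 0)) ` I)"
      using finIJ by (simp add: measure_measure_pmf_finite)
    also have "\<dots> \<le> measure_pmf.prob p {(b, d). d = 0}"
      by (intro measure_pmf.finite_measure_mono) auto
    finally show ?thesis .
  qed
  finally show ?thesis using \<kappa> by (simp add: divide_right_mono)
qed

section \<open>Union bound over the bad events\<close>

lemma map_fst_superdiagonal_joint_law:
  "map_pmf fst (superdiagonal_joint_law n i j l) = superdiagonal_law n i l"
  "map_pmf snd (superdiagonal_joint_law n i j l) = superdiagonal_law n j l"
  by (simp_all add: superdiagonal_joint_law_def superdiagonal_law_def map_pmf_comp)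

lemma prob_not_full_step_le:
  fixes n l m :: nat and N :: real
  assumes n: "4 \<le> n" and l: "0 < l" and N: "0 < N" and m: "2 \<le> m"
  defines "\<sigma> \<equiv> sqrt (real n / real l)"
  shows "1 - measure_pmf.prob (pair_pmf (random_walk n l) (random_walk n l))
      {(V, W). nilpotency_step (subgroup_generated (unitriangular_group n) {V, W}) = n - 1}
    \<le> (2 * N + 1) * \<sigma> + \<sigma> + 1 / (real m - 1) + real n * (\<sigma>\<^sup>2 + \<sigma> * real m / N)"
proof -
  define M where "M = random_walk n l"
  define H where "H i = superdiagonal_law n i l" for i
  define J where "J j = superdiagonal_joint_law n 0 j l" for j
  define e where "e A i = A $$ (i, Suc i)" for A :: "int mat" and i
  let ?P = "measure_pmf.prob (pair_pmf M M)"
  have H_rad: "radially_decreasing (pmf (H i))" if "Suc i < n" for i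
    unfolding H_def using that n by (intro radially_decreasing_superdiagonal_law) auto
  have H_fin: "finite (set_pmf (H i))" for i
    using finite_set_random_walk[of n l] n by (simp add: H_def superdiagonal_law_def)
  have H_0: "pmf (H i) 0 \<le> \<sigma>" if "Suc i < n" for i
    unfolding H_def \<sigma>_def using that n l by (intro pmf_superdiagonal_law_at_0_le) auto
  have \<sigma>0: "0 \<le> \<sigma>" by (simp add: \<sigma>_def)
  have n0: "Suc 0 < n" using n by simp
  have pair_H: "pair_pmf (H i) (H j) = map_pmf (\<lambda>(V, W). (e V i, e W j)) (pair_pmf M M)" for i j
    unfolding H_def superdiagonal_law_def M_def e_def by (rule map_pair[symmetric])
  have pair_J: "pair_pmf (J j) (J j) = map_pmf (\<lambda>(V, W). ((e V 0, e V j), (e W 0, e W j))) (pair_pmf M M)" for j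
    unfolding J_def superdiagonal_joint_law_def M_def e_def by (rule map_pair[symmetric])
  have marg: "measure_pmf.prob (H i) A = ?P {(V, W). e V i \<in> A}"
    "measure_pmf.prob (H i) A = ?P {(V, W). e W i \<in> A}" for i A
  proof -
    have "H i = map_pmf (\<lambda>(V, W). e V i) (pair_pmf M M)" "H i = map_pmf (\<lambda>(V, W). e W i) (pair_pmf M M)"
      using map_fst_pair_pmf[of M M] map_snd_pair_pmf[of M M]
        map_pmf_comp[of "\<lambda>A. e A i" fst "pair_pmf M M"] map_pmf_comp[of "\<lambda>A. e A i" snd "pair_pmf M M"]
      by (simp_all add: H_def superdiagonal_law_def e_def M_def case_prod_unfold)
    note H = this
    show "measure_pmf.prob (H i) A = ?P {(V, W). e V i \<in> A}"
      by (subst H(1)) (simp add: vimage_def case_prod_unfold)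
    show "measure_pmf.prob (H i) A = ?P {(V, W). e W i \<in> A}"
      by (subst H(2)) (simp add: vimage_def case_prod_unfold)
  qed
  define B1 where "B1 = {(V, W :: int mat). e V 0 \<in> {a. \<bar>real_of_int a\<bar> < N}}"
  \<comment> \<open>If the first entry of \<open>W\<close> is zero, the gcd is the absolute value of
    that of \<open>V\<close>. This case is set apart because the gcd estimate concerns nonzero pairs
    only.\<close>
  define B2 where "B2 = {(V :: int mat, W). e W 0 \<in> {0}}"
  define B3 where "B3 = {(V, W). e V 0 \<noteq> 0 \<and> e W 0 \<noteq> 0 \<and> int m \<le> gcd (e V 0) (e W 0)}"
  define C where "C j = {(V, W). e V j = 0 \<and> e W j = 0}" for j
  \<comment> \<open>The threshold is \<open>\<kappa> = N / m\<close>: outside \<open>B1\<close>,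
    \<open>B2\<close> and \<open>B3\<close> the first entry of \<open>V\<close> is at least
    \<open>N\<close> in absolute value and the gcd is below \<open>m\<close>, so the last condition
    is automatic.\<close>
  define D where "D j = {(V, W). e V 0 * e W j = e W 0 * e V j \<and> e V j \<noteq> 0 \<and> e V 0 \<noteq> 0 \<and>
      N / real m * real_of_int (gcd (e V 0) (e W 0)) \<le> \<bar>real_of_int (e V 0)\<bar>}" for j
  have B1: "?P B1 \<le> (2 * N + 1) * \<sigma>"
  proof -
    have "?P B1 \<le> (2 * N + 1) * pmf (H 0) 0"
      unfolding B1_def marg(1)[symmetric] by (rule prob_small_le[OF H_rad[OF n0] N])
    also have "\<dots> \<le> (2 * N + 1) * \<sigma>" using N H_0[OF n0] by (intro mult_left_mono) auto
    finally show ?thesis .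
  qed
  have B2: "?P B2 \<le> \<sigma>"
    unfolding B2_def marg(2)[symmetric] measure_pmf_single using H_0[OF n0] .
  have B3: "?P B3 \<le> 1 / (real m - 1)"
    using prob_large_gcd_le[OF H_rad[OF n0] H_fin H_rad[OF n0] H_fin m]
    by (simp add: pair_H B3_def vimage_def case_prod_unfold)
  have C: "?P (C j) \<le> \<sigma>\<^sup>2" if "Suc j < n" for j
  proof -
    have "?P (C j) = measure_pmf.prob (pair_pmf (H j) (H j)) {(0, 0)}"
      by (auto simp: pair_H C_def vimage_def case_prod_unfold intro!: arg_cong[where f = ?P])
    also have "\<dots> = pmf (H j) 0 * pmf (H j) 0" by (simp add: measure_pmf_single pmf_pair)
    also have "\<dots> \<le> \<sigma>\<^sup>2"
      using H_0[OF that] \<sigma>0 by (simp add: power2_eq_square mult_mono)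
    finally show ?thesis .
  qed
  have D: "?P (D j) \<le> \<sigma> * real m / N" if "1 \<le> j" "Suc j < n" for j
  proof -
    have "?P (D j) = measure_pmf.prob (pair_pmf (J j) (J j)) {((a, c), (b, d)). a * d = b * c \<and> c \<noteq> 0 \<and>
        a \<noteq> 0 \<and> N / real m * real_of_int (gcd a b) \<le> \<bar>real_of_int a\<bar>}"
      by (simp add: pair_J D_def vimage_def case_prod_unfold)
    also have "\<dots> \<le> measure_pmf.prob (J j) {(b, d). d = 0} / (N / real m)"
    proof (rule prob_parallel_le)
      show "radially_decreasing (\<lambda>c. pmf (J j) (a, c))" for a
        unfolding J_def using that n by (intro radially_decreasing_superdiagonal_joint_law) auto
      show "finite (set_pmf (J j))"
        using finite_set_random_walk[of n l] n by (simp add: J_def superdiagonal_joint_law_def)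
    qed (use N m in auto)
    also have "measure_pmf.prob (J j) {(b, d). d = 0} = pmf (H j) 0"
    proof -
      have "pmf (H j) 0 = measure_pmf.prob (map_pmf snd (J j)) {0}"
        by (simp add: measure_pmf_single map_fst_superdiagonal_joint_law H_def J_def)
      then show ?thesis by (simp add: vimage_def case_prod_unfold)
    qed
    also have "\<dots> / (N / real m) \<le> \<sigma> / (N / real m)"
      using H_0[OF that(2)] N by (intro divide_right_mono) auto
    finally show ?thesis by simp
  qed
  define full where "full = {(V, W). nilpotency_step (subgroup_generated (unitriangular_group n) {V, W}) = n - 1}"
  define bad where "bad = B1 \<union> B2 \<union> B3 \<union> (\<Union>j\<in>{1..<n - 1}. C j \<union> D j)"
  have "1 - ?P full = ?P (- full)"
    using measure_pmf.prob_compl[of full "pair_pmf M M"] by (simp add: Compl_eq_Diff_UNIV)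
  \<comment> \<open>The algebraic criterion speaks about unitriangular matrices only, hence the
    restriction to the support.\<close>
  also have "\<dots> = ?P (- full \<inter> set_pmf (pair_pmf M M))" by (rule measure_Int_set_pmf[symmetric])
  also have "\<dots> \<le> ?P bad"
  proof (intro measure_pmf.finite_measure_mono subsetI)
    fix z assume z: "z \<in> - full \<inter> set_pmf (pair_pmf M M)"
    obtain V W where VW: "z = (V, W)" by (cases z)
    have U: "V \<in> carrier (unitriangular_group n)" "W \<in> carrier (unitriangular_group n)"
      using z set_random_walk[of n l] n by (auto simp: VW M_def)
    show "z \<in> bad"
    proof (rule ccontr)
      assume good: "z \<notin> bad"
      then have g: "N \<le> \<bar>real_of_int (e V 0)\<bar>" "e W 0 \<noteq> 0" "e V 0 = 0 \<or> gcd (e V 0) (e W 0) < int m"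
        by (auto simp: bad_def VW B1_def B2_def B3_def)
      then have V0: "e V 0 \<noteq> 0" "gcd (e V 0) (e W 0) < int m" using N by auto
      have "N / real m * real_of_int (gcd (e V 0) (e W 0)) \<le> N / real m * real m"
        using V0 N by (intro mult_left_mono) auto
      then have ga: "N / real m * real_of_int (gcd (e V 0) (e W 0)) \<le> \<bar>real_of_int (e V 0)\<bar>"
        using g(1) m by simp
      have "e V 0 * e W j \<noteq> e W 0 * e V j" if j: "1 \<le> j" "Suc j < n" for j
      proof
        assume eq: "e V 0 * e W j = e W 0 * e V j"
        have nj: "z \<notin> C j" "z \<notin> D j" using good j by (auto simp: bad_def)
        show False
        \<comment> \<open>If the entry of \<open>V\<close> at \<open>j\<close> is zero, parallelism
          and a nonzero first entry of \<open>V\<close> make that of \<open>W\<close> zero too,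
          which is \<open>C j\<close>; otherwise \<open>D j\<close> occurs.\<close>
        proof (cases "e V j = 0")
          case True
          then show False using eq V0 nj(1) by (simp add: C_def VW)
        next
          case False
          then show False using eq V0 ga nj(2) by (simp add: D_def VW)
        qed
      qed
      then have "nilpotency_step (subgroup_generated (unitriangular_group n) {V, W}) = n - 1"
        using n V0(1) by (intro full_step_criterion U) (auto simp: e_def)
      then show False using z by (simp add: full_def VW)
    qed
  qed simp
  also have "\<dots> \<le> ?P B1 + ?P B2 + ?P B3 + ?P (\<Union>j\<in>{1..<n - 1}. C j \<union> D j)"
  proof -
    have Un: "?P (X \<union> Y) \<le> ?P X + ?P Y" for X Y by (intro measure_Un_le) auto
    show ?thesis
      using Un[of "B1 \<union> B2 \<union> B3" "\<Union>j\<in>{1..<n - 1}. C j \<union> D j"] Un[of "B1 \<union> B2" B3] Un[of B1 B2]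
      unfolding bad_def by linarith
  qed
  also have "?P (\<Union>j\<in>{1..<n - 1}. C j \<union> D j) \<le> (\<Sum>j\<in>{1..<n - 1}. ?P (C j \<union> D j))"
    by (intro measure_UNION_le) auto
  also have "\<dots> \<le> (\<Sum>j\<in>{1..<n - 1}. \<sigma>\<^sup>2 + \<sigma> * real m / N)"
  proof (rule sum_mono)
    fix j assume "j \<in> {1..<n - 1}"
    then have j: "1 \<le> j" "Suc j < n" by auto
    have "?P (C j \<union> D j) \<le> ?P (C j) + ?P (D j)" by (intro measure_Un_le) auto
    then show "?P (C j \<union> D j) \<le> \<sigma>\<^sup>2 + \<sigma> * real m / N" using C[OF j(2)] D[OF j] by linarith
  qed
  also have "\<dots> \<le> real n * (\<sigma>\<^sup>2 + \<sigma> * real m / N)"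
    using n N \<sigma>0 by (simp add: mult_right_mono)
  finally show ?thesis
    using B1 B2 B3 by (simp add: full_def M_def)
qed

section \<open>Choice of the parameters and the limit\<close>

theorem theorem2:
  fixes l :: "nat \<Rightarrow> nat"
  assumes "(\<lambda>n. real (l n)) \<in> \<omega>(\<lambda>n. real n ^ 2)"
  shows "(\<lambda>n. measure_pmf.prob (pair_pmf (random_walk n (l n)) (random_walk n (l n)))
            {(V, W). nilpotency_step (subgroup_generated (unitriangular_group n) {V, W}) = n - 1})
         \<longlonglongrightarrow> 1"
proof -
  define P where "P n = measure_pmf.prob (pair_pmf (random_walk n (l n)) (random_walk n (l n)))
    {(V, W). nilpotency_step (subgroup_generated (unitriangular_group n) {V, W}) = n - 1}" for n
  \<comment> \<open>The scale is set by
    \<open>t\<^sup>4 = n * \<sigma>\<^sup>2 = n\<^sup>2 / l\<close>. With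
    \<open>N = t / \<sigma>\<close> and \<open>m\<close> about \<open>1 / t\<close>, the events of
    small first entry and large gcd cost order \<open>t\<close>, and the sum over \<open>j\<close>
    costs order \<open>t\<^sup>2\<close>.\<close>
  define t where "t n = sqrt (sqrt (real n ^ 2 / real (l n)))" for n
  have small: "(\<lambda>n. real n ^ 2) \<in> o(\<lambda>n. real (l n))"
    using assms by (simp add: smallomega_iff_smallo)
  have t: "t \<longlonglongrightarrow> 0"
    unfolding t_def using tendsto_real_sqrt[OF tendsto_real_sqrt[OF smalloD_tendsto[OF small]]] by simp
  \<comment> \<open>This supplies \<open>0 < l n\<close>, so that \<open>t n\<close> and
    \<open>\<sigma>\<close> are positive and the divisions below are genuine.\<close>
  have "\<forall>\<^sub>F n in sequentially. real n ^ 2 \<le> real (l n)"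
    using landau_o.smallD[OF small, of 1] by simp
  then have upper: "\<forall>\<^sub>F n in sequentially. 1 - P n \<le> 3 * t n + 3 * t n ^ 2 + 3 * t n ^ 3 + t n ^ 4"
    using eventually_ge_at_top[of 4]
  proof eventually_elim
    case (elim n)
    have "0 < real n ^ 2" using elim by simp
    then have l0: "0 < l n" using elim by (metis of_nat_0_less_iff order_less_le_trans)
    define \<sigma> where "\<sigma> = sqrt (real n / real (l n))"
    \<comment> \<open>The summand \<open>2\<close> ensures \<open>2 \<le> m\<close> and leaves
      \<open>m - 1 \<ge> 1 / t n\<close> after the subtraction.\<close>
    define m where "m = nat \<lceil>1 / t n\<rceil> + 2"
    have t0: "0 < t n" using l0 elim by (simp add: t_def)
    have \<sigma>0: "0 < \<sigma>" using l0 elim by (simp add: \<sigma>_def)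
    have t4: "t n ^ 4 = real n * \<sigma>\<^sup>2"
    proof -
      have "t n ^ 4 = ((t n)\<^sup>2)\<^sup>2" by simp
      also have "\<dots> = real n ^ 2 / real (l n)" by (simp add: t_def)
      finally show ?thesis by (simp add: \<sigma>_def power2_eq_square)
    qed
    \<comment> \<open>The two stray terms \<open>\<sigma>\<close> are absorbed because
      \<open>\<sigma>\<^sup>2 \<le> n * \<sigma>\<^sup>2 = t\<^sup>4\<close>.\<close>
    have "\<sigma> \<le> (t n)\<^sup>2"
    proof (rule power2_le_imp_le)
      have "1 * \<sigma>\<^sup>2 \<le> real n * \<sigma>\<^sup>2" using elim by (intro mult_right_mono) auto
      then show "\<sigma>\<^sup>2 \<le> ((t n)\<^sup>2)\<^sup>2" using t4 by simp
    qed simp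
    have m1: "1 / t n + 1 \<le> real m - 1" "real m \<le> 1 / t n + 3"
    proof -
      have "0 \<le> \<lceil>1 / t n\<rceil>" using t0 by (simp add: le_ceiling_iff order_less_trans[of _ 0])
      then have "real m = real_of_int \<lceil>1 / t n\<rceil> + 2" by (simp add: m_def)
      then show "1 / t n + 1 \<le> real m - 1" "real m \<le> 1 / t n + 3"
        using ceiling_correct[of "1 / t n"] by linarith+
    qed
    have "1 - P n \<le> (2 * (t n / \<sigma>) + 1) * \<sigma> + \<sigma> + 1 / (real m - 1) +
        real n * (\<sigma>\<^sup>2 + \<sigma> * real m / (t n / \<sigma>))"
      unfolding P_def \<sigma>_def by (rule prob_not_full_step_le)
        (use elim l0 t0 \<sigma>0 in \<open>auto simp: m_def \<sigma>_def\<close>)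
    moreover have "(2 * (t n / \<sigma>) + 1) * \<sigma> = 2 * t n + \<sigma>" using \<sigma>0 by (simp add: field_simps)
    moreover have "1 / (real m - 1) \<le> t n"
    proof -
      have "0 < 1 / t n" using t0 by simp
      moreover have "1 / t n \<le> real m - 1" using m1 by linarith
      moreover have "2 \<le> m" by (simp add: m_def)
      ultimately have "1 / (real m - 1) \<le> 1 / (1 / t n)"
        by (intro divide_left_mono mult_pos_pos) auto
      then show ?thesis by simp
    qed
    moreover have "real n * (\<sigma>\<^sup>2 + \<sigma> * real m / (t n / \<sigma>)) \<le> t n ^ 4 + t n ^ 2 + 3 * t n ^ 3"
    proof -
      have "real n * (\<sigma>\<^sup>2 + \<sigma> * real m / (t n / \<sigma>)) = real n * \<sigma>\<^sup>2 + real n * \<sigma>\<^sup>2 * (real m / t n)"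
        by (simp add: power2_eq_square algebra_simps)
      also have "\<dots> = t n ^ 4 + t n ^ 4 * (real m / t n)" by (simp only: t4)
      also have "t n ^ 4 * (real m / t n) \<le> t n ^ 4 * ((1 / t n + 3) / t n)"
        using m1 t0 by (intro mult_left_mono divide_right_mono) auto
      also have "\<dots> = t n ^ 2 + 3 * t n ^ 3"
        using t0 by (simp add: field_simps power2_eq_square power3_eq_cube power4_eq_xxxx)
      finally show ?thesis by simp
    qed
    ultimately show ?case using \<open>\<sigma> \<le> (t n)\<^sup>2\<close> by linarith
  qed
  have lower: "\<forall>\<^sub>F n in sequentially. 0 \<le> 1 - P n" by (simp add: P_def)
  have "(\<lambda>n. 3 * t n + 3 * t n ^ 2 + 3 * t n ^ 3 + t n ^ 4) \<longlonglongrightarrow> 0"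
    using t by (auto intro!: tendsto_eq_intros)
  then have "(\<lambda>n. 1 - P n) \<longlonglongrightarrow> 0"
    by (rule tendsto_sandwich[OF lower upper tendsto_const])
  then have "(\<lambda>n. 1 - (1 - P n)) \<longlonglongrightarrow> 1 - 0" by (rule tendsto_diff[OF tendsto_const])
  then show ?thesis by (simp add: P_def)
qed

end
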